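(* For the class $\mathcal{C}=\mathrm{Forb}(C_4)$ of all connected graphs that do not contain the cycle $C_4$ with four vertices as a topological minor, we have $\kappa=1$ and $\sigma^2=(5-\sqrt5)/2$.
   Context: Graphs are finite, simple, undirected and vertex-labelled. $\mathcal{B}\subset\mathcal{C}$ is the subclass of graphs in $\mathcal{C}$ that are 2-connected (connected, at least three vertices, no cutvertex) or consist of a single edge with its two ends. $C(z)=\sum_n|\mathcal{C}_n|z^n/n!$ and $B(z)=\sum_n|\mathcal{B}_n|z^n/n!$ are the exponential generating functions (a subscript $n$ denotes the objects with vertex set $\{1,\dots,n\}$); $\rho$ is the radius of convergence of $C(z)$, $C^\bullet(z)=zC'(z)$ and $y=C^\bullet(\rho)$, which is the unique positive solution of $yB''(y)=1$. A $\mathcal{B}'^\bullet$-object on a finite set $U$ is a graph in $\mathcal{B}$ with vertex set $U\cup\{*\}$, $*\notin U$, together with a distinguished root vertex in $U$; its size $|\cdot|$ is $|U|$; the exponential generating function is $B'^\bullet(z)=zB''(z)$. The scaling factor is $\kappa=\mathbb{E}[\mathsf{sp}(\mathsf{B})]$, where $\mathsf{sp}(\mathsf{B})$ is the graph distance in $\mathsf{B}$ from $*$ to the root and $\mathsf{B}\in\mathcal{B}'^\bullet$ follows the Boltzmann distribution with parameter $y$: each object on label set $\{1,\dots,m\}$ has probability $y^m/(m!\,B'^\bullet(y))$. Also $\sigma^2=\mathbb{E}[|\mathsf{B}|]=1+B'''(y)y^2$. *)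

theory Defs
  imports
    "HOL-Analysis.FPS_Convergence"
    "HOL-Probability.Probability_Mass_Function"
    "Graph_Theory.Digraph_Component"
    "Graph_Theory.Digraph_Isomorphism"
    "Graph_Theory.Pair_Digraph"
    "Graph_Theory.Shortest_Path"
    "Graph_Theory.Subdivision"
begin

text \<open>
  A finite simple undirected graph is a value of type \<^typ>\<open>'a pair_pre_digraph\<close> satisfying
  \<^const>\<open>pair_graph\<close>: a finite vertex set with a symmetric irreflexive set of arcs on it, each edge
  \<open>{u, v}\<close> being represented by the two arcs \<open>(u, v)\<close> and \<open>(v, u)\<close>. A class of labelled graphs
  is a set of such graphs with vertices in \<open>nat\<close>.
\<close>

definition cycle_graph :: "nat \<Rightarrow> nat pair_pre_digraph" where
  "cycle_graph n =
     \<lparr> pverts = {0..<n},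
       parcs = {(i, j). i < n \<and> j < n \<and> (j = (i + 1) mod n \<or> i = (j + 1) mod n)} \<rparr>"

text \<open>The vertex type of \<open>K\<close> is no restriction: subdividing only adds vertices, so \<open>K\<close> can be
  taken on the branch vertices in \<open>G\<close>.\<close>

definition topological_minor :: "'b pair_pre_digraph \<Rightarrow> 'a pair_pre_digraph \<Rightarrow> bool" where
  "topological_minor H G \<longleftrightarrow>
     (\<exists>K S. digraph_iso (with_proj H) (with_proj K) \<and> subdivision_pair K S \<and>
            subgraph (with_proj S) (with_proj G))"

definition cutvertex :: "'a pair_pre_digraph \<Rightarrow> 'a \<Rightarrow> bool" where
  "cutvertex G v \<longleftrightarrow> v \<in> pverts G \<and>
     (\<exists>a b. a \<noteq> v \<and> b \<noteq> v \<and> a \<rightarrow>\<^sup>*\<^bsub>with_proj G\<^esub> b \<and>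
            \<not> a \<rightarrow>\<^sup>*\<^bsub>pre_digraph.del_vert (with_proj G) v\<^esub> b)"

definition two_connected :: "'a pair_pre_digraph \<Rightarrow> bool" where
  "two_connected G \<longleftrightarrow> pair_graph G \<and> Digraph_Component.connected (with_proj G) \<and>
     card (pverts G) \<ge> 3 \<and> \<not> (\<exists>v. cutvertex G v)"

definition single_edge :: "'a pair_pre_digraph \<Rightarrow> bool" where
  "single_edge G \<longleftrightarrow> (\<exists>u v. u \<noteq> v \<and> G = \<lparr> pverts = {u, v}, parcs = {(u, v), (v, u)} \<rparr>)"

definition Forb :: "nat pair_pre_digraph \<Rightarrow> nat pair_pre_digraph set" where
  "Forb H = {G. pair_graph G \<and> Digraph_Component.connected (with_proj G) \<and> \<not> topological_minor H G}"

definition blocks_of :: "nat pair_pre_digraph set \<Rightarrow> nat pair_pre_digraph set" where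
  "blocks_of C = {G \<in> C. two_connected G \<or> single_edge G}"

definition egf :: "nat pair_pre_digraph set \<Rightarrow> real fps" where
  "egf C = Abs_fps (\<lambda>n. real (card {G \<in> C. pverts G = {1..n}}) / fact n)"

definition rho :: "nat pair_pre_digraph set \<Rightarrow> real" where
  "rho C = real_of_ereal (fps_conv_radius (egf C))"

text \<open>The value \<open>C\<^sup>\<bullet>(\<rho>)\<close> of \<open>C\<^sup>\<bullet>(z) = z C'(z)\<close> on the boundary of the disc of convergence.\<close>

definition y_param :: "nat pair_pre_digraph set \<Rightarrow> real" where
  "y_param C = eval_fps (fps_X * fps_deriv (egf C)) (rho C)"

text \<open>Objects of \<open>B'\<^sup>\<bullet>\<close> on the label set \<open>{1..m}\<close>, as pairs of a graph and its root; the extra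
  vertex \<open>*\<close> is the number \<open>0\<close>.\<close>

definition dp_objects ::
    "nat pair_pre_digraph set \<Rightarrow> nat \<Rightarrow> (nat pair_pre_digraph \<times> nat) set" where
  "dp_objects B m = {(G, r). G \<in> B \<and> pverts G = insert 0 {1..m} \<and> r \<in> {1..m}}"

definition dp_size :: "nat pair_pre_digraph \<times> nat \<Rightarrow> nat" where
  "dp_size = (\<lambda>(G, r). card (pverts G - {0}))"

text \<open>\<open>B'\<^sup>\<bullet>(z) = z B''(z)\<close>.\<close>

definition dp_egf :: "nat pair_pre_digraph set \<Rightarrow> real fps" where
  "dp_egf B = fps_X * fps_deriv (fps_deriv (egf B))"

text \<open>Graph distance from \<open>*\<close> to the root: every arc has weight one.\<close>

definition sp :: "nat pair_pre_digraph \<times> nat \<Rightarrow> real" where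
  "sp = (\<lambda>(G, r). real_of_ereal (wf_digraph.\<mu> (with_proj G) (\<lambda>_. 1) 0 r))"

text \<open>\<^const>\<open>embed_pmf\<close> is meaningful because the weights sum to one whenever \<open>y > 0\<close> and
  \<open>0 < B'\<^sup>\<bullet>(y) < \<infinity>\<close>.\<close>

definition boltzmann_dp ::
    "nat pair_pre_digraph set \<Rightarrow> real \<Rightarrow> (nat pair_pre_digraph \<times> nat) pmf" where
  "boltzmann_dp B y = embed_pmf (\<lambda>X.
     if X \<in> (\<Union>m. dp_objects B m)
     then y ^ dp_size X / (fact (dp_size X) * eval_fps (dp_egf B) y) else 0)"

definition kappa :: "nat pair_pre_digraph set \<Rightarrow> real" where
  "kappa C = measure_pmf.expectation (boltzmann_dp (blocks_of C) (y_param C)) sp"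

definition sigma_sq :: "nat pair_pre_digraph set \<Rightarrow> real" where
  "sigma_sq C =
     measure_pmf.expectation (boltzmann_dp (blocks_of C) (y_param C)) (\<lambda>X. real (dp_size X))"

end

theory Submission
  imports Defs
begin

text \<open>
  A connected graph without a \<open>C\<^sub>4\<close> topological minor is a triangular cactus: every edge is a bridge
  or lies in a triangle whose removal separates its three vertices. Hence the blocks are the single
  edge and the triangle, \<open>B''(z) = 1 + z\<close>, and \<open>y B''(y) = 1\<close> reads \<open>y(1 + y) = 1\<close>. The root and the
  distinguished vertex \<open>*\<close> of a block are always adjacent, so \<open>\<kappa> = 1\<close>, and \<open>\<sigma>\<^sup>2 = 1 + y\<^sup>2\<close>.

  To identify \<open>y = T(\<rho>)\<close> for \<open>T = z C'(z)\<close>, fix two vertices \<open>r\<close> and \<open>s\<close> and cut a cactus at the block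
  containing \<open>r\<close> that leads to \<open>s\<close>: this gives two cacti if the block is a bridge, three if it is a
  triangle. Counting, \<open>C'' = C' T' (1 + T)\<close>, which integrates to \<open>T = z exp(T + T\<^sup>2/2)\<close>. As
  \<open>t exp(-t - t\<^sup>2/2)\<close> has its maximum at \<open>y\<close>, the radius of convergence is that maximum and
  \<open>T(\<rho>) = y\<close>.
\<close>

unbundle no vec_syntax
unbundle fps_syntax

section \<open>Triangular cacti\<close>

text \<open>The cactus condition is imposed arc by arc (\<open>in_block\<close>) and not by a
  recursive construction: in this form it passes to parts and to glued graphs by reachability
  arguments alone, and it is equivalent to the absence of cycles with four or more vertices. Two
  vertices \<open>r\<close> and \<open>s\<close> are fixed because the block at \<open>r\<close>
  leading to \<open>s\<close> is then determined by the graph; the decomposition becomes a bijection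
  without any theory of block trees, at the price of a differential equation in place of a
  functional one. The obstacle in the analysis is that nothing is known about convergence
  beforehand. The equation is therefore first integrated as an inequality between polynomial
  truncations, which bounds the partial sums of \<open>T\<close> at the candidate radius, and only
  then exactly inside the disc. The value on the boundary is reached by monotonicity of series with
  nonnegative terms, and the tangent inequality \<open>1 + s \<le> exp s\<close> replaces a
  discussion of the maximum.\<close>

definition edge_arcs :: "'a \<Rightarrow> 'a \<Rightarrow> 'a rel" where
  "edge_arcs u v = {(u, v), (v, u)}"

definition tri_arcs :: "'a \<Rightarrow> 'a \<Rightarrow> 'a \<Rightarrow> 'a rel" where
  "tri_arcs u v w = {(u, v), (v, u), (u, w), (w, u), (v, w), (w, v)}"

definition bridge :: "'a rel \<Rightarrow> 'a \<Rightarrow> 'a \<Rightarrow> bool" where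
  "bridge E u v \<longleftrightarrow> (u, v) \<in> E \<and> (u, v) \<notin> (E - edge_arcs u v)\<^sup>*"

definition tri_block :: "'a rel \<Rightarrow> 'a \<Rightarrow> 'a \<Rightarrow> 'a \<Rightarrow> bool" where
  "tri_block E u v w \<longleftrightarrow> tri_arcs u v w \<subseteq> E \<and> (u, v) \<notin> (E - tri_arcs u v w)\<^sup>* \<and>
     (u, w) \<notin> (E - tri_arcs u v w)\<^sup>* \<and> (v, w) \<notin> (E - tri_arcs u v w)\<^sup>*"

definition in_block :: "'a rel \<Rightarrow> 'a \<Rightarrow> 'a \<Rightarrow> bool" where
  "in_block E u v \<longleftrightarrow> bridge E u v \<or> (\<exists>w. tri_block E u v w)"

definition cacti :: "'a set \<Rightarrow> 'a rel set" where
  "cacti V = {E. E \<subseteq> V \<times> V \<and> sym E \<and> V \<times> V \<subseteq> E\<^sup>* \<and> (\<forall>(u, v)\<in>E. in_block E u v)}"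

lemma cactiI:
  assumes "E \<subseteq> V \<times> V" "sym E" "\<And>x y. x \<in> V \<Longrightarrow> y \<in> V \<Longrightarrow> (x, y) \<in> E\<^sup>*"
    "\<And>u v. (u, v) \<in> E \<Longrightarrow> in_block E u v"
  shows "E \<in> cacti V"
  using assms unfolding cacti_def by auto

lemma cactiD:
  assumes "E \<in> cacti V"
  shows cacti_subset: "E \<subseteq> V \<times> V" and cacti_sym: "sym E"
    and cacti_connected: "\<And>x y. x \<in> V \<Longrightarrow> y \<in> V \<Longrightarrow> (x, y) \<in> E\<^sup>*"
    and cacti_in_block: "\<And>u v. (u, v) \<in> E \<Longrightarrow> in_block E u v"
  using assms unfolding cacti_def by auto

lemma bridge_neq: "bridge E u v \<Longrightarrow> u \<noteq> v"
  unfolding bridge_def by auto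

lemma tri_block_neq: "tri_block E u v w \<Longrightarrow> u \<noteq> v \<and> u \<noteq> w \<and> v \<noteq> w"
  unfolding tri_block_def by auto

lemma cacti_irrefl: "E \<in> cacti V \<Longrightarrow> (x, x) \<notin> E"
  by (metis bridge_neq cacti_in_block in_block_def tri_block_neq)

lemma finite_cacti: "finite V \<Longrightarrow> finite (cacti V)"
  by (rule finite_subset[of _ "Pow (V \<times> V)"]) (auto simp: cacti_def)

lemma sym_edge_arcs: "sym (edge_arcs u v)"
  by (auto simp: sym_def edge_arcs_def)

lemma sym_tri_arcs: "sym (tri_arcs u v w)"
  by (auto simp: sym_def tri_arcs_def)

lemma sym_rtranclD: "sym E \<Longrightarrow> (x, y) \<in> E\<^sup>* \<Longrightarrow> (y, x) \<in> E\<^sup>*"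
  using sym_rtrancl by (metis symD)

text \<open>A map that sends arcs to arcs or collapses them sends paths to paths. It serves for
  collapsing hanging parts to one vertex and for relabelling.\<close>

lemma rtrancl_retract:
  assumes "(x, y) \<in> E\<^sup>*" "\<And>a b. (a, b) \<in> E \<Longrightarrow> f a = f b \<or> (f a, f b) \<in> F"
  shows "(f x, f y) \<in> F\<^sup>*"
  using assms(1)
proof (induction rule: rtrancl_induct)
  case (step y z)
  then show ?case using assms(2)[OF step(2)] by (auto intro: rtrancl_into_rtrancl)
qed simp

lemma rtrancl_closed:
  assumes "(x, y) \<in> E\<^sup>*" "x \<in> X" "\<And>a b. (a, b) \<in> E \<Longrightarrow> a \<in> X \<Longrightarrow> b \<in> X"
  shows "y \<in> X"
  using assms by (induction rule: rtrancl_induct) auto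

text \<open>Collapsing everything outside \<open>V1\<close> to the attachment vertex \<open>a\<close> retracts \<open>E\<close> onto \<open>E1\<close>,
  so enlarging a graph by parts hanging at one vertex creates no new connections.\<close>

lemma in_block_glue:
  assumes "in_block E1 u v" "E1 \<subseteq> V1 \<times> V1" "E1 \<subseteq> E"
    and ext: "\<And>x y. (x, y) \<in> E \<Longrightarrow> (x, y) \<notin> E1 \<Longrightarrow> x \<notin> V1 - {a} \<and> y \<notin> V1 - {a}"
  shows "in_block E u v"
proof -
  define f where "f x = (if x \<in> V1 then x else a)" for x
  have retr: "(x, y) \<in> (E1 - D)\<^sup>*" if "(x, y) \<in> (E - D)\<^sup>*" "x \<in> V1" "y \<in> V1" for x y D
  proof -
    have "(f x, f y) \<in> (E1 - D)\<^sup>*"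
    proof (rule rtrancl_retract[OF that(1)])
      fix p q assume pq: "(p, q) \<in> E - D"
      show "f p = f q \<or> (f p, f q) \<in> E1 - D"
      proof (cases "(p, q) \<in> E1")
        case True
        then have "p \<in> V1" "q \<in> V1" using assms(2) by auto
        then show ?thesis using True pq by (simp add: f_def)
      next
        case False
        then show ?thesis using ext[of p q] pq by (auto simp: f_def)
      qed
    qed
    then show ?thesis using that by (simp add: f_def)
  qed
  from assms(1) consider "bridge E1 u v" | w where "tri_block E1 u v w"
    unfolding in_block_def by auto
  then show ?thesis
  proof cases
    case 1
    then show ?thesis
      unfolding in_block_def bridge_def using assms(2,3) retr[of u v "edge_arcs u v"] by blast
  next
    case 2
    then have "(u, v) \<in> E1" "(u, w) \<in> E1" by (auto simp: tri_block_def tri_arcs_def)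
    then have V: "u \<in> V1" "v \<in> V1" "w \<in> V1" using assms(2) by auto
    have "tri_block E u v w"
      using 2 V retr[of _ _ "tri_arcs u v w"] assms(3) unfolding tri_block_def by blast
    then show ?thesis unfolding in_block_def by blast
  qed
qed

text \<open>Discarding arcs preserves separation, so the only danger is losing the third vertex of a
  triangle. It cannot lie outside \<open>X\<close>: both \<open>u\<close> and \<open>v\<close> would
  have an arc leaving \<open>X\<close>, hence both would equal \<open>a\<close>.\<close>

lemma in_block_restrict:
  assumes "in_block E u v" "u \<in> X" "v \<in> X"
    and exit: "\<And>x y. (x, y) \<in> E \<Longrightarrow> x \<in> X \<Longrightarrow> y \<notin> X \<Longrightarrow> x = a"
  shows "in_block (E \<inter> X \<times> X) u v"
proof -
  from assms(1) consider "bridge E u v" | w where "tri_block E u v w"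
    unfolding in_block_def by auto
  then show ?thesis
  proof cases
    case 1
    have "(E \<inter> X \<times> X - edge_arcs u v)\<^sup>* \<subseteq> (E - edge_arcs u v)\<^sup>*"
      by (rule rtrancl_mono) auto
    then show ?thesis using 1 assms(2,3) unfolding in_block_def bridge_def by blast
  next
    case 2
    have E: "(u, w) \<in> E" "(v, w) \<in> E" using 2 by (auto simp: tri_block_def tri_arcs_def)
    have "u \<noteq> v" using tri_block_neq[OF 2] by simp
    then have w: "w \<in> X" using exit[OF E(1)] exit[OF E(2)] assms(2,3) by auto
    have "(E \<inter> X \<times> X - tri_arcs u v w)\<^sup>* \<subseteq> (E - tri_arcs u v w)\<^sup>*"
      by (rule rtrancl_mono) auto
    moreover have "tri_arcs u v w \<subseteq> X \<times> X" using w assms(2,3) by (auto simp: tri_arcs_def)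
    ultimately have "tri_block (E \<inter> X \<times> X) u v w" using 2 unfolding tri_block_def by blast
    then show ?thesis unfolding in_block_def by blast
  qed
qed

lemma rtrancl_restrict:
  assumes "(x, y) \<in> E\<^sup>*" "x \<in> X" "\<And>a b. (a, b) \<in> E \<Longrightarrow> a \<in> X \<Longrightarrow> b \<in> X"
  shows "(x, y) \<in> (E \<inter> X \<times> X)\<^sup>*"
  using assms(1)
proof (induction rule: rtrancl_induct)
  case (step y z)
  then have "y \<in> X" using rtrancl_closed assms(2,3) by metis
  then show ?case using step assms(3)[OF step(2)] by (auto intro: rtrancl_into_rtrancl)
qed simp

text \<open>Applied with \<open>F\<close> equal to \<open>E\<close> minus the arcs of one block and
  \<open>a\<close> a vertex of that block. The only way out of \<open>X\<close> is at
  \<open>a\<close>, as \<open>in_block_restrict\<close> requires; connectedness comes from the paths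
  of \<open>F\<close> that define \<open>X\<close>.\<close>

lemma cacti_component:
  assumes E: "E \<in> cacti V" and F: "F \<subseteq> E" "sym F" and a: "a \<in> V"
    and X: "X = {x. (a, x) \<in> F\<^sup>*}"
    and exit: "\<And>x y. (x, y) \<in> E \<Longrightarrow> (x, y) \<notin> F \<Longrightarrow> x \<in> X \<Longrightarrow> x = a \<and> y \<notin> X"
  shows "E \<inter> X \<times> X \<in> cacti X"
proof (rule cactiI)
  show "E \<inter> X \<times> X \<subseteq> X \<times> X" by auto
  show "sym (E \<inter> X \<times> X)" using cacti_sym[OF E] by (auto simp: sym_def)
  have cl: "y \<in> X" if "(x, y) \<in> F" "x \<in> X" for x y
    using that unfolding X by (auto intro: rtrancl_into_rtrancl)
  have ax: "(a, x) \<in> (F \<inter> X \<times> X)\<^sup>*" if "x \<in> X" for x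
    using that X by (intro rtrancl_restrict) (auto intro: rtrancl_into_rtrancl)
  have "sym (F \<inter> X \<times> X)" using F(2) by (auto simp: sym_def)
  then have "(x, y) \<in> (F \<inter> X \<times> X)\<^sup>*" if "x \<in> X" "y \<in> X" for x y
    using ax[OF that(1)] ax[OF that(2)] sym_rtranclD rtrancl_trans by metis
  moreover have "(F \<inter> X \<times> X)\<^sup>* \<subseteq> (E \<inter> X \<times> X)\<^sup>*" using F(1) by (intro rtrancl_mono) auto
  ultimately show "(x, y) \<in> (E \<inter> X \<times> X)\<^sup>*" if "x \<in> X" "y \<in> X" for x y
    using that by blast
  fix u v assume uv: "(u, v) \<in> E \<inter> X \<times> X"
  show "in_block (E \<inter> X \<times> X) u v"
  proof (rule in_block_restrict[where a = a])
    show "in_block E u v" using uv cacti_in_block[OF E] by auto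
    show "x = a" if "(x, y) \<in> E" "x \<in> X" "y \<notin> X" for x y
      using that exit cl by blast
  qed (use uv in auto)
qed

section \<open>Gluing and splitting at a bridge or a triangle\<close>

lemma edge_arcs_commute: "edge_arcs u v = edge_arcs v u"
  by (auto simp: edge_arcs_def)

lemma tri_arcs_commute: "tri_arcs u v w = tri_arcs v u w" "tri_arcs u v w = tri_arcs u w v"
  by (auto simp: tri_arcs_def)

lemma in_block_sym:
  assumes "sym E" "in_block E u v"
  shows "in_block E v u"
proof -
  have D: "sym (E - edge_arcs u v)" "\<And>w. sym (E - tri_arcs u v w)"
    using assms(1) by (auto simp: sym_def edge_arcs_def tri_arcs_def)
  from assms(2) consider "bridge E u v" | w where "tri_block E u v w"
    unfolding in_block_def by auto
  then show ?thesis
  proof cases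
    case 1
    then show ?thesis
      using assms(1) sym_rtranclD[OF D(1), of v u] edge_arcs_commute[of u v]
      unfolding in_block_def bridge_def by (metis symD)
  next
    case 2
    then show ?thesis
      using sym_rtranclD[OF D(2), of v u] tri_arcs_commute(1)[of u v]
      unfolding in_block_def tri_block_def by metis
  qed
qed

lemma rtrancl_via:
  assumes "sym E" "(a, x) \<in> E\<^sup>*" "(a, y) \<in> E\<^sup>*"
  shows "(x, y) \<in> E\<^sup>*"
  using sym_rtranclD[OF assms(1,2)] assms(3) by (rule rtrancl_trans)

lemma tri_block_permute:
  assumes "sym E" and tri: "tri_block E a b c"
  shows "tri_block E a c b" "tri_block E b c a"
proof -
  have D: "tri_arcs a c b = tri_arcs a b c" "tri_arcs b c a = tri_arcs a b c"
    by (auto simp: tri_arcs_def)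
  have sym: "sym (E - tri_arcs a b c)" using assms(1) by (auto simp: sym_def tri_arcs_def)
  show "tri_block E a c b" "tri_block E b c a"
    using tri sym_rtranclD[OF sym] unfolding tri_block_def D by blast+
qed

text \<open>Relative to either part, everything else hangs at the single vertex \<open>a\<close> or
  \<open>b\<close>, which is the situation of \<open>in_block_glue\<close>. The new edge is a bridge
  because \<open>V1\<close> is closed under the remaining arcs.\<close>

lemma cacti_glue_edge:
  assumes E1: "E1 \<in> cacti V1" and E2: "E2 \<in> cacti V2" and disj: "V1 \<inter> V2 = {}"
    and a: "a \<in> V1" and b: "b \<in> V2"
  shows "E1 \<union> E2 \<union> edge_arcs a b \<in> cacti (V1 \<union> V2)"
proof -
  let ?E = "E1 \<union> E2 \<union> edge_arcs a b"
  note sub = cacti_subset[OF E1] cacti_subset[OF E2]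
  have sym: "sym ?E"
    by (intro sym_Un cacti_sym[OF E1] cacti_sym[OF E2] sym_edge_arcs)
  show ?thesis
  proof (rule cactiI)
    show "?E \<subseteq> (V1 \<union> V2) \<times> (V1 \<union> V2)" using sub a b by (auto simp: edge_arcs_def)
    have mono: "E1\<^sup>* \<subseteq> ?E\<^sup>*" "E2\<^sup>* \<subseteq> ?E\<^sup>*" by (auto intro!: rtrancl_mono)
    have "(a, x) \<in> ?E\<^sup>*" if "x \<in> V1" for x using cacti_connected[OF E1 a that] mono by auto
    moreover have "(a, x) \<in> ?E\<^sup>*" if "x \<in> V2" for x
      using cacti_connected[OF E2 b that] mono
      by - (rule converse_rtrancl_into_rtrancl[of a b]; auto simp: edge_arcs_def)
    ultimately show "(x, y) \<in> ?E\<^sup>*" if "x \<in> V1 \<union> V2" "y \<in> V1 \<union> V2" for x y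
      using that by - (rule rtrancl_via[OF sym, of a]; blast)
    have "(a, b) \<notin> (?E - edge_arcs a b)\<^sup>*"
    proof
      assume "(a, b) \<in> (?E - edge_arcs a b)\<^sup>*"
      then have "b \<in> V1" by (rule rtrancl_closed) (use sub disj a in auto)
      then show False using b disj by auto
    qed
    then have ab: "in_block ?E a b" unfolding in_block_def bridge_def by (auto simp: edge_arcs_def)
    show "in_block ?E u v" if uv: "(u, v) \<in> ?E" for u v
    proof -
      consider "(u, v) \<in> E1" | "(u, v) \<in> E2" | "u = a" "v = b" | "u = b" "v = a"
        using uv unfolding edge_arcs_def by blast
      then show ?thesis
      proof cases
        case 1
        show ?thesis
          by (rule in_block_glue[OF cacti_in_block[OF E1 1] sub(1), of _ a])
            (use sub disj b in \<open>auto simp: edge_arcs_def\<close>)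
      next
        case 2
        show ?thesis
          by (rule in_block_glue[OF cacti_in_block[OF E2 2] sub(2), of _ b])
            (use sub disj a in \<open>auto simp: edge_arcs_def\<close>)
      qed (use ab in_block_sym[OF sym ab] in auto)
    qed
  qed (rule sym)
qed

lemma cacti_glue_triangle:
  assumes E1: "E1 \<in> cacti V1" and E2: "E2 \<in> cacti V2" and E3: "E3 \<in> cacti V3"
    and disj: "V1 \<inter> V2 = {}" "V1 \<inter> V3 = {}" "V2 \<inter> V3 = {}"
    and a: "a \<in> V1" and b: "b \<in> V2" and c: "c \<in> V3"
  shows "E1 \<union> E2 \<union> E3 \<union> tri_arcs a b c \<in> cacti (V1 \<union> V2 \<union> V3)"
proof -
  let ?D = "tri_arcs a b c"
  let ?E = "E1 \<union> E2 \<union> E3 \<union> ?D"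
  let ?V = "V1 \<union> V2 \<union> V3"
  note sub = cacti_subset[OF E1] cacti_subset[OF E2] cacti_subset[OF E3]
  have sym: "sym ?E"
    by (intro sym_Un cacti_sym[OF E1] cacti_sym[OF E2] cacti_sym[OF E3] sym_tri_arcs)
  show ?thesis
  proof (rule cactiI)
    show "?E \<subseteq> ?V \<times> ?V" using sub a b c by (auto simp: tri_arcs_def)
    have mono: "E1\<^sup>* \<subseteq> ?E\<^sup>*" "E2\<^sup>* \<subseteq> ?E\<^sup>*" "E3\<^sup>* \<subseteq> ?E\<^sup>*"
      by (rule rtrancl_mono; blast)+
    have "(a, x) \<in> ?E\<^sup>*" if "x \<in> V1" for x using cacti_connected[OF E1 a that] mono by auto
    moreover have "(a, x) \<in> ?E\<^sup>*" if "x \<in> V2" for x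
      using cacti_connected[OF E2 b that] mono
      by - (rule converse_rtrancl_into_rtrancl[of a b]; auto simp: tri_arcs_def)
    moreover have "(a, x) \<in> ?E\<^sup>*" if "x \<in> V3" for x
      using cacti_connected[OF E3 c that] mono
      by - (rule converse_rtrancl_into_rtrancl[of a c]; auto simp: tri_arcs_def)
    ultimately show "(x, y) \<in> ?E\<^sup>*" if "x \<in> ?V" "y \<in> ?V" for x y
      using that by - (rule rtrancl_via[OF sym, of a]; blast)
    have cl: "y \<in> X" if "(x, y) \<in> (?E - ?D)\<^sup>*" "x \<in> X" "X = V1 \<or> X = V2" for x y X
      by (rule rtrancl_closed[OF that(1,2)]) (use sub disj that(3) in auto)
    have blk: "tri_block ?E a b c"
      unfolding tri_block_def using cl[of a b V1] cl[of a c V1] cl[of b c V2] a b c disj by blast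
    have D: "in_block ?E u v" if "(u, v) \<in> ?D" for u v
    proof -
      have "in_block ?E a b" "in_block ?E a c" "in_block ?E b c"
        using blk tri_block_permute[OF sym blk] unfolding in_block_def by blast+
      then show ?thesis using in_block_sym[OF sym] that by (auto simp: tri_arcs_def)
    qed
    show "in_block ?E u v" if uv: "(u, v) \<in> ?E" for u v
    proof -
      consider "(u, v) \<in> E1" | "(u, v) \<in> E2" | "(u, v) \<in> E3" | "(u, v) \<in> ?D"
        using uv by blast
      then show ?thesis
      proof cases
        case 1
        show ?thesis
          by (rule in_block_glue[OF cacti_in_block[OF E1 1] sub(1), of _ a])
            (use sub disj b c in \<open>auto simp: tri_arcs_def\<close>)
      next
        case 2
        show ?thesis
          by (rule in_block_glue[OF cacti_in_block[OF E2 2] sub(2), of _ b])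
            (use sub disj a c in \<open>auto simp: tri_arcs_def\<close>)
      next
        case 3
        show ?thesis
          by (rule in_block_glue[OF cacti_in_block[OF E3 3] sub(3), of _ c])
            (use sub disj a b in \<open>auto simp: tri_arcs_def\<close>)
      qed (rule D)
    qed
  qed (rule sym)
qed

text \<open>The parts are the components of \<open>a\<close> and \<open>b\<close> once the bridge is
  removed. They cover \<open>V\<close> because a path from \<open>a\<close> can change component
  only along the bridge, and a common vertex would give a detour around it.\<close>

lemma cacti_split_bridge:
  assumes E: "E \<in> cacti V" and br: "bridge E a b"
  obtains V1 V2 where "V1 \<union> V2 = V" "V1 \<inter> V2 = {}" "a \<in> V1" "b \<in> V2"
    "E \<inter> V1 \<times> V1 \<in> cacti V1" "E \<inter> V2 \<times> V2 \<in> cacti V2"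
    "E = E \<inter> V1 \<times> V1 \<union> E \<inter> V2 \<times> V2 \<union> edge_arcs a b"
proof -
  define F where "F = E - edge_arcs a b"
  define C where "C x = {y. (x, y) \<in> F\<^sup>*}" for x
  note sub = cacti_subset[OF E]
  have ab: "(a, b) \<in> E" "(b, a) \<in> E" "(a, b) \<notin> F\<^sup>*"
    using br cacti_sym[OF E] by (auto simp: bridge_def F_def sym_def)
  have symF: "sym F" using cacti_sym[OF E] by (auto simp: F_def sym_def edge_arcs_def)
  have CI: "x \<in> C x" for x by (auto simp: C_def)
  have cl: "z \<in> C x" if "(y, z) \<in> F" "y \<in> C x" for x y z
    using that unfolding C_def by (auto intro: rtrancl_into_rtrancl)
  have disj: "C a \<inter> C b = {}"
    using ab(3) sym_rtranclD[OF symF] unfolding C_def by (auto dest: rtrancl_trans)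
  have V: "a \<in> V" "b \<in> V" using ab sub by auto
  have CV: "C x \<subseteq> V" if "x \<in> V" for x
    using rtrancl_closed[of x _ F V] that sub unfolding C_def F_def by blast
  have "x \<in> C a \<union> C b" if "x \<in> V" for x
  proof (rule rtrancl_closed[OF cacti_connected[OF E V(1) that]])
    show "z \<in> C a \<union> C b" if "(y, z) \<in> E" "y \<in> C a \<union> C b" for y z
      using that cl[of y z] CI by (cases "(y, z) \<in> F") (auto simp: F_def edge_arcs_def)
  qed (use CI in auto)
  then have un: "C a \<union> C b = V" using CV V by auto
  have sides: "E \<inter> C x \<times> C x \<in> cacti (C x)" if "x = a \<or> x = b" for x
  proof (rule cacti_component[OF E _ symF _ C_def])
    show "F \<subseteq> E" by (auto simp: F_def)
    show "y = x \<and> z \<notin> C x" if "(y, z) \<in> E" "(y, z) \<notin> F" "y \<in> C x" for y z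
      using that \<open>x = a \<or> x = b\<close> disj CI by (auto simp: F_def edge_arcs_def)
  qed (use that V in auto)
  have "E \<subseteq> E \<inter> C a \<times> C a \<union> E \<inter> C b \<times> C b \<union> edge_arcs a b"
  proof
    fix p assume p: "p \<in> E"
    obtain x y where xy: "p = (x, y)" by (cases p)
    show "p \<in> E \<inter> C a \<times> C a \<union> E \<inter> C b \<times> C b \<union> edge_arcs a b"
      using p un sub cl[of x y] unfolding xy F_def by blast
  qed
  moreover have "edge_arcs a b \<subseteq> E" using ab by (auto simp: edge_arcs_def)
  ultimately have "E = E \<inter> C a \<times> C a \<union> E \<inter> C b \<times> C b \<union> edge_arcs a b" by blast
  then show thesis using that[OF un disj CI CI sides sides] by simp
qed

lemma cacti_split_triangle:
  assumes E: "E \<in> cacti V" and tri: "tri_block E a b c"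
  obtains V1 V2 V3 where "V1 \<union> V2 \<union> V3 = V" "V1 \<inter> V2 = {}" "V1 \<inter> V3 = {}" "V2 \<inter> V3 = {}"
    "a \<in> V1" "b \<in> V2" "c \<in> V3"
    "E \<inter> V1 \<times> V1 \<in> cacti V1" "E \<inter> V2 \<times> V2 \<in> cacti V2" "E \<inter> V3 \<times> V3 \<in> cacti V3"
    "E = E \<inter> V1 \<times> V1 \<union> E \<inter> V2 \<times> V2 \<union> E \<inter> V3 \<times> V3 \<union> tri_arcs a b c"
proof -
  define F where "F = E - tri_arcs a b c"
  define C where "C x = {y. (x, y) \<in> F\<^sup>*}" for x
  note sub = cacti_subset[OF E]
  have D: "tri_arcs a b c \<subseteq> E" "(a, b) \<notin> F\<^sup>*" "(a, c) \<notin> F\<^sup>*" "(b, c) \<notin> F\<^sup>*"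
    using tri by (auto simp: tri_block_def F_def)
  have symF: "sym F" using cacti_sym[OF E] by (auto simp: F_def sym_def tri_arcs_def)
  have CI: "x \<in> C x" for x by (auto simp: C_def)
  have cl: "z \<in> C x" if "(y, z) \<in> F" "y \<in> C x" for x y z
    using that unfolding C_def by (auto intro: rtrancl_into_rtrancl)
  have disj: "C a \<inter> C b = {}" "C a \<inter> C c = {}" "C b \<inter> C c = {}"
    using D(2-4) sym_rtranclD[OF symF] unfolding C_def by (auto dest: rtrancl_trans)
  have V: "a \<in> V" "b \<in> V" "c \<in> V" using D(1) sub by (auto simp: tri_arcs_def)
  have CV: "C x \<subseteq> V" if "x \<in> V" for x
    using rtrancl_closed[of x _ F V] that sub unfolding C_def F_def by blast
  have "x \<in> C a \<union> C b \<union> C c" if "x \<in> V" for x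
  proof (rule rtrancl_closed[OF cacti_connected[OF E V(1) that]])
    show "z \<in> C a \<union> C b \<union> C c" if "(y, z) \<in> E" "y \<in> C a \<union> C b \<union> C c" for y z
      using that cl[of y z] CI by (cases "(y, z) \<in> F") (auto simp: F_def tri_arcs_def)
  qed (use CI in auto)
  then have un: "C a \<union> C b \<union> C c = V" using CV V by auto
  have sides: "E \<inter> C x \<times> C x \<in> cacti (C x)" if "x = a \<or> x = b \<or> x = c" for x
  proof (rule cacti_component[OF E _ symF _ C_def])
    show "F \<subseteq> E" by (auto simp: F_def)
    show "y = x \<and> z \<notin> C x" if "(y, z) \<in> E" "(y, z) \<notin> F" "y \<in> C x" for y z
      using that \<open>x = a \<or> x = b \<or> x = c\<close> disj CI[of a] CI[of b] CI[of c]
      by (auto simp: F_def tri_arcs_def)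
  qed (use that V in auto)
  have "E \<subseteq> E \<inter> C a \<times> C a \<union> E \<inter> C b \<times> C b \<union> E \<inter> C c \<times> C c \<union> tri_arcs a b c"
  proof
    fix p assume p: "p \<in> E"
    obtain x y where xy: "p = (x, y)" by (cases p)
    show "p \<in> E \<inter> C a \<times> C a \<union> E \<inter> C b \<times> C b \<union> E \<inter> C c \<times> C c \<union> tri_arcs a b c"
      using p un sub cl[of x y] unfolding xy F_def by blast
  qed
  then have "E = E \<inter> C a \<times> C a \<union> E \<inter> C b \<times> C b \<union> E \<inter> C c \<times> C c \<union> tri_arcs a b c"
    using D(1) by blast
  then show thesis using that[OF un disj CI CI CI sides sides sides] by simp
qed

section \<open>Cutting a cactus at a block\<close>

text \<open>The part of \<open>E\<close> that \<open>r\<close> separates from the rest and that contains \<open>s\<close>. In a cactus the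
  neighbours of \<open>r\<close> in it are the other vertices of the block at \<open>r\<close> leading to \<open>s\<close>, so the cut can be read off from
  the graph.\<close>

definition far_side :: "'a rel \<Rightarrow> 'a \<Rightarrow> 'a \<Rightarrow> 'a set" where
  "far_side E r s = {x. (s, x) \<in> (E \<inter> (-{r}) \<times> (-{r}))\<^sup>*}"

text \<open>\<open>K\<close> is connected by arcs that avoid \<open>r\<close>, and all arcs leaving
  \<open>K\<close> end at \<open>r\<close>; so \<open>K\<close> is the component of \<open>s\<close>
  once \<open>r\<close> is deleted.\<close>

lemma far_side_eq:
  assumes "s \<in> K" "r \<notin> K" "F \<in> cacti K" "F \<subseteq> E"
    and exit: "\<And>x y. (x, y) \<in> E \<Longrightarrow> x \<in> K \<Longrightarrow> y \<notin> K \<Longrightarrow> y = r"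
  shows "far_side E r s = K"
proof
  show "far_side E r s \<subseteq> K"
    unfolding far_side_def using rtrancl_closed[of s _ "E \<inter> (-{r}) \<times> (-{r})" K] assms(1) exit by blast
  have "F \<subseteq> E \<inter> (-{r}) \<times> (-{r})" using cacti_subset[OF assms(3)] assms(2,4) by auto
  then show "K \<subseteq> far_side E r s"
    unfolding far_side_def using cacti_connected[OF assms(3,1)] rtrancl_mono by blast
qed

text \<open>\<open>K\<close> is the part cut off at \<open>r\<close> that contains \<open>s\<close>,
  and \<open>v\<close> is the end in \<open>K\<close> of the bridge at \<open>r\<close>.\<close>

definition edge_data :: "'a set \<Rightarrow> 'a \<Rightarrow> 'a \<Rightarrow> ('a set \<times> 'a \<times> 'a rel \<times> 'a rel) set" where
  "edge_data V r s = (SIGMA K:{K. K \<subseteq> V - {r} \<and> s \<in> K}. SIGMA v:K. cacti (V - K) \<times> cacti K)"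

definition glue_edge :: "'a \<Rightarrow> 'a set \<times> 'a \<times> 'a rel \<times> 'a rel \<Rightarrow> 'a rel" where
  "glue_edge r = (\<lambda>(K, v, E1, E2). E1 \<union> E2 \<union> edge_arcs r v)"

text \<open>Removing the triangle splits \<open>K\<close> into \<open>U\<close>, the side of
  \<open>s\<close>, and \<open>K - U\<close>. Naming the side of \<open>s\<close> first orders the
  two far triangle vertices \<open>u\<close> and \<open>w\<close>, so that each triangle arises
  once.\<close>

definition triangle_data ::
    "'a set \<Rightarrow> 'a \<Rightarrow> 'a \<Rightarrow> ('a set \<times> 'a set \<times> 'a \<times> 'a \<times> 'a rel \<times> 'a rel \<times> 'a rel) set" where
  "triangle_data V r s = (SIGMA K:{K. K \<subseteq> V - {r} \<and> s \<in> K}. SIGMA U:{U. U \<subseteq> K \<and> s \<in> U}.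
     SIGMA u:U. SIGMA w:K - U. cacti (V - K) \<times> cacti U \<times> cacti (K - U))"

definition glue_triangle ::
    "'a \<Rightarrow> 'a set \<times> 'a set \<times> 'a \<times> 'a \<times> 'a rel \<times> 'a rel \<times> 'a rel \<Rightarrow> 'a rel" where
  "glue_triangle r = (\<lambda>(K, U, u, w, E1, E2, E3). E1 \<union> E2 \<union> E3 \<union> tri_arcs r u w)"

text \<open>After the first clause, each one recovers a component of the data from the glued
  relation alone, as injectivity requires.\<close>

lemma glue_edge_props:
  assumes "(K, v, E1, E2) \<in> edge_data V r s" and r: "r \<in> V"
    and E: "E = glue_edge r (K, v, E1, E2)"
  shows "E \<in> cacti V" "far_side E r s = K" "{x \<in> K. (r, x) \<in> E} = {v}"
    "E \<inter> K \<times> K = E2" "E \<inter> (V - K) \<times> (V - K) = E1"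
proof -
  have K: "K \<subseteq> V" "r \<notin> K" "s \<in> K" "v \<in> K" and E1: "E1 \<in> cacti (V - K)" and E2: "E2 \<in> cacti K"
    using assms(1) by (auto simp: edge_data_def)
  note sub = cacti_subset[OF E1] cacti_subset[OF E2]
  have E': "E = E1 \<union> E2 \<union> edge_arcs r v" by (simp add: E glue_edge_def)
  show "E \<in> cacti V"
  proof -
    have "(V - K) \<inter> K = {}" "V - K \<union> K = V" using K by auto
    then show ?thesis using cacti_glue_edge[OF E1 E2, of r v] K r by (simp add: E')
  qed
  show "far_side E r s = K"
    by (rule far_side_eq[OF K(3,2) E2]) (use sub K in \<open>auto simp: E' edge_arcs_def\<close>)
  show "{x \<in> K. (r, x) \<in> E} = {v}" "E \<inter> K \<times> K = E2" "E \<inter> (V - K) \<times> (V - K) = E1"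
    using sub K by (auto simp: E' edge_arcs_def)
qed

text \<open>\<open>K\<close> and the unordered pair \<open>{u, w}\<close> are visible in
  \<open>E\<close>. Deleting the edge between \<open>u\<close> and \<open>w\<close> inside
  \<open>K\<close> leaves \<open>U\<close> as the component of \<open>s\<close>, and
  \<open>U\<close> then tells \<open>u\<close> from \<open>w\<close>.\<close>

lemma glue_triangle_props:
  assumes "(K, U, u, w, E1, E2, E3) \<in> triangle_data V r s" and r: "r \<in> V"
    and E: "E = glue_triangle r (K, U, u, w, E1, E2, E3)"
  shows "E \<in> cacti V" "far_side E r s = K" "{x \<in> K. (r, x) \<in> E} = {u, w}" "u \<in> U" "w \<notin> U"
    "{x. (s, x) \<in> (E \<inter> K \<times> K - edge_arcs u w)\<^sup>*} = U"
    "E \<inter> U \<times> U = E2" "E \<inter> (K - U) \<times> (K - U) = E3" "E \<inter> (V - K) \<times> (V - K) = E1"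
proof -
  have K: "K \<subseteq> V" "r \<notin> K" "s \<in> U" "U \<subseteq> K" "u \<in> U" "w \<in> K - U"
    and E1: "E1 \<in> cacti (V - K)" and E2: "E2 \<in> cacti U" and E3: "E3 \<in> cacti (K - U)"
    using assms(1) by (auto simp: triangle_data_def)
  note sub = cacti_subset[OF E1] cacti_subset[OF E2] cacti_subset[OF E3]
  have E': "E = E1 \<union> E2 \<union> E3 \<union> tri_arcs r u w" by (simp add: E glue_triangle_def)
  have UK: "U \<union> (K - U) = K" "V - K \<union> U \<union> (K - U) = V" using K by auto
  show "E \<in> cacti V"
    using cacti_glue_triangle[OF E1 E2 E3, of r u w] K r unfolding UK E' by auto
  have F: "E2 \<union> E3 \<union> edge_arcs u w \<in> cacti K"
    using cacti_glue_edge[OF E2 E3, of u w] K unfolding UK by auto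
  have sK: "s \<in> K" using K by auto
  show "far_side E r s = K"
    by (rule far_side_eq[OF sK K(2) F]) (use sub K in \<open>auto simp: E' tri_arcs_def edge_arcs_def\<close>)
  show "{x \<in> K. (r, x) \<in> E} = {u, w}" "u \<in> U" "w \<notin> U" "E \<inter> U \<times> U = E2"
    "E \<inter> (K - U) \<times> (K - U) = E3" "E \<inter> (V - K) \<times> (V - K) = E1"
    using sub K by (auto simp: E' tri_arcs_def)
  have "E \<inter> K \<times> K - edge_arcs u w = E2 \<union> E3"
    using sub K by (auto simp: E' tri_arcs_def edge_arcs_def)
  moreover have "{x. (s, x) \<in> (E2 \<union> E3)\<^sup>*} \<subseteq> U"
    using rtrancl_closed[of s _ "E2 \<union> E3" U] sub K by blast
  moreover have "U \<subseteq> {x. (s, x) \<in> (E2 \<union> E3)\<^sup>*}"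
    using cacti_connected[OF E2 K(3)] rtrancl_mono[of E2 "E2 \<union> E3"] by blast
  ultimately show "{x. (s, x) \<in> (E \<inter> K \<times> K - edge_arcs u w)\<^sup>*} = U" by auto
qed

lemma inj_on_glue_edge:
  assumes "r \<in> V"
  shows "inj_on (glue_edge r) (edge_data V r s)"
proof (rule inj_onI)
  fix p q assume p: "p \<in> edge_data V r s" and q: "q \<in> edge_data V r s"
    and eq: "glue_edge r p = glue_edge r q"
  obtain K v E1 E2 where p': "p = (K, v, E1, E2)" by (cases p)
  obtain K' v' E1' E2' where q': "q = (K', v', E1', E2')" by (cases q)
  note P = glue_edge_props[OF p[unfolded p'] assms refl]
  note Q = glue_edge_props[OF q[unfolded q'] assms refl, folded q', folded eq, unfolded p']
  have "K = K'" using P(2) Q(2) by simp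
  moreover have "{v} = {v'}" using P(3) Q(3) \<open>K = K'\<close> by simp
  moreover have "E1 = E1'" "E2 = E2'" using P(4,5) Q(4,5) \<open>K = K'\<close> by simp_all
  ultimately show "p = q" by (simp add: p' q')
qed

lemma inj_on_glue_triangle:
  assumes "r \<in> V"
  shows "inj_on (glue_triangle r) (triangle_data V r s)"
proof (rule inj_onI)
  fix p q assume p: "p \<in> triangle_data V r s" and q: "q \<in> triangle_data V r s"
    and eq: "glue_triangle r p = glue_triangle r q"
  obtain K U u w E1 E2 E3 where p': "p = (K, U, u, w, E1, E2, E3)" by (cases p)
  obtain K' U' u' w' E1' E2' E3' where q': "q = (K', U', u', w', E1', E2', E3')" by (cases q)
  note P = glue_triangle_props[OF p[unfolded p'] assms refl]
  note Q = glue_triangle_props[OF q[unfolded q'] assms refl, folded q', folded eq, unfolded p']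
  have K: "K = K'" using P(2) Q(2) by simp
  have N: "{u, w} = {u', w'}" using P(3) Q(3) K by simp
  then have "edge_arcs u w = edge_arcs u' w'" by (auto simp: edge_arcs_def doubleton_eq_iff)
  then have U: "U = U'" using P(6) Q(6) K by simp
  have "u = u' \<and> w = w'" using N P(4,5) Q(4,5) U by (auto simp: doubleton_eq_iff)
  moreover have "E1 = E1'" "E2 = E2'" "E3 = E3'" using P(7-9) Q(7-9) K U by simp_all
  ultimately show "p = q" using K U by (simp add: p' q')
qed

text \<open>The number of neighbours of \<open>r\<close> in \<open>far_side E r s\<close> is one for
  a bridge and two for a triangle.\<close>

lemma glue_disjoint:
  assumes "r \<in> V"
  shows "glue_edge r ` edge_data V r s \<inter> glue_triangle r ` triangle_data V r s = {}"
proof -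
  have False if p: "p \<in> edge_data V r s" and q: "q \<in> triangle_data V r s"
    and eq: "glue_edge r p = glue_triangle r q" for p q
  proof -
    obtain K v E1 E2 where p': "p = (K, v, E1, E2)" by (cases p)
    obtain K' U' u' w' E1' E2' E3' where q': "q = (K', U', u', w', E1', E2', E3')" by (cases q)
    note P = glue_edge_props[OF p[unfolded p'] assms refl]
    note Q = glue_triangle_props[OF q[unfolded q'] assms refl, folded q', folded eq, unfolded p']
    have "{v} = {u', w'}" using P(2,3) Q(2,3) by simp
    then show False using Q(4,5) by auto
  qed
  then show ?thesis by blast
qed

text \<open>Some neighbour \<open>v\<close> of \<open>r\<close> is joined to \<open>s\<close>
  without passing through \<open>r\<close>; the cut is made at the block of the arc
  \<open>(r, v)\<close>.\<close>

lemma cacti_decompose: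
  assumes E: "E \<in> cacti V" and r: "r \<in> V" and s: "s \<in> V" and rs: "r \<noteq> s"
  shows "E \<in> glue_edge r ` edge_data V r s \<union> glue_triangle r ` triangle_data V r s"
proof -
  let ?F = "E \<inter> (-{r}) \<times> (-{r})"
  have symF: "sym ?F" using cacti_sym[OF E] by (auto simp: sym_def)
  \<comment> \<open>Otherwise the complement of \<open>far_side E r s\<close> would be closed under
    \<open>E\<close>, and \<open>s\<close> could not be reached from \<open>r\<close>.\<close>
  have "\<exists>v\<in>far_side E r s. (r, v) \<in> E"
  proof (rule ccontr)
    assume no: "\<not> ?thesis"
    have "r \<notin> far_side E r s"
      using rtrancl_closed[of s r ?F "-{r}"] rs unfolding far_side_def by blast
    then have "s \<in> - far_side E r s"
    proof (intro rtrancl_closed[OF cacti_connected[OF E r s]])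
      fix x y assume xy: "(x, y) \<in> E" "x \<in> - far_side E r s"
      show "y \<in> - far_side E r s"
      proof
        assume y: "y \<in> far_side E r s"
        then have "x \<noteq> r" "y \<noteq> r" using no xy \<open>r \<notin> far_side E r s\<close> by auto
        then have "(y, x) \<in> ?F" using xy cacti_sym[OF E] by (auto simp: sym_def)
        then show False
          using xy y unfolding far_side_def by (auto intro: rtrancl_into_rtrancl)
      qed
    qed simp
    then show False by (simp add: far_side_def)
  qed
  then obtain v where v: "(s, v) \<in> ?F\<^sup>*" "(r, v) \<in> E" unfolding far_side_def by auto
  have vs: "(v, s) \<in> ?F\<^sup>*" using sym_rtranclD[OF symF v(1)] .
  from cacti_in_block[OF E v(2)] consider "bridge E r v" | w where "tri_block E r v w"
    unfolding in_block_def by auto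
  then show ?thesis
  proof cases
    case 1
    obtain V1 V2 where S: "V1 \<union> V2 = V" "V1 \<inter> V2 = {}" "r \<in> V1" "v \<in> V2"
      "E \<inter> V1 \<times> V1 \<in> cacti V1" "E \<inter> V2 \<times> V2 \<in> cacti V2"
      "E = E \<inter> V1 \<times> V1 \<union> E \<inter> V2 \<times> V2 \<union> edge_arcs r v"
      by (rule cacti_split_bridge[OF E 1])
    have "s \<in> V2"
    proof (rule rtrancl_closed[OF vs S(4)])
      fix x y assume "(x, y) \<in> ?F" "x \<in> V2"
      then show "y \<in> V2" using S(2,3) S(7) unfolding edge_arcs_def by blast
    qed
    moreover have "V - V2 = V1" using S by auto
    ultimately have "(V2, v, E \<inter> V1 \<times> V1, E \<inter> V2 \<times> V2) \<in> edge_data V r s"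
      using S by (auto simp: edge_data_def)
    moreover have "E = glue_edge r (V2, v, E \<inter> V1 \<times> V1, E \<inter> V2 \<times> V2)"
      using S(7) by (simp add: glue_edge_def)
    ultimately show ?thesis by blast
  next
    case 2
    obtain V1 V2 V3 where S: "V1 \<union> V2 \<union> V3 = V" "V1 \<inter> V2 = {}" "V1 \<inter> V3 = {}" "V2 \<inter> V3 = {}"
      "r \<in> V1" "v \<in> V2" "w \<in> V3"
      "E \<inter> V1 \<times> V1 \<in> cacti V1" "E \<inter> V2 \<times> V2 \<in> cacti V2" "E \<inter> V3 \<times> V3 \<in> cacti V3"
      "E = E \<inter> V1 \<times> V1 \<union> E \<inter> V2 \<times> V2 \<union> E \<inter> V3 \<times> V3 \<union> tri_arcs r v w"
      by (rule cacti_split_triangle[OF E 2])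
    \<comment> \<open>A path from \<open>v\<close> to \<open>s\<close> that avoids \<open>r\<close>
      cannot enter \<open>V1\<close>, whose only attachment is \<open>r\<close>.\<close>
    have sV: "s \<in> V2 \<union> V3"
    proof (rule rtrancl_closed[OF vs])
      fix x y assume "(x, y) \<in> ?F" "x \<in> V2 \<union> V3"
      then show "y \<in> V2 \<union> V3" using S(2-7) S(11) unfolding tri_arcs_def by blast
    qed (use S(6) in auto)
    \<comment> \<open>\<open>s\<close> may lie on the side of either far triangle vertex.
      \<open>A\<close> is the side of \<open>s\<close> and \<open>a\<close> its triangle vertex, so
      that both cases are instances.\<close>
    have goal: ?thesis if "s \<in> A" "A \<union> B = V2 \<union> V3" "A \<inter> B = {}" "a \<in> A" "b \<in> B"
      "E \<inter> A \<times> A \<in> cacti A" "E \<inter> B \<times> B \<in> cacti B"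
      "E = E \<inter> V1 \<times> V1 \<union> E \<inter> A \<times> A \<union> E \<inter> B \<times> B \<union> tri_arcs r a b" for A B a b
    proof -
      have "V - (A \<union> B) = V1" "A \<union> B - A = B" using S(1-4) that(2,3) by auto
      then have "(A \<union> B, A, a, b, E \<inter> V1 \<times> V1, E \<inter> A \<times> A, E \<inter> B \<times> B) \<in> triangle_data V r s"
        using that(1,4-7) S(1-5,8) that(2,3) by (auto simp: triangle_data_def)
      moreover have
        "E = glue_triangle r (A \<union> B, A, a, b, E \<inter> V1 \<times> V1, E \<inter> A \<times> A, E \<inter> B \<times> B)"
        using that(8) by (simp add: glue_triangle_def)
      ultimately show ?thesis by blast
    qed
    from sV show ?thesis
    proof (rule UnE)
      assume "s \<in> V2"
      then show ?thesis by (rule goal[of V2 V3 v w]) (use S in blast)+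
    next
      assume "s \<in> V3"
      moreover have "E = E \<inter> V1 \<times> V1 \<union> E \<inter> V3 \<times> V3 \<union> E \<inter> V2 \<times> V2 \<union> tri_arcs r w v"
        using S(11) tri_arcs_commute(2)[of r v w] by blast
      ultimately show ?thesis by (intro goal[of V3 V2 w v]) (use S(2-10) in blast)+
    qed
  qed
qed

text \<open>The factors \<open>card K\<close>, \<open>card U\<close> and \<open>card (K - U)\<close>
  count the choices of the attachment vertex, so every part except that of \<open>r\<close> enters
  as a rooted cactus.\<close>

lemma card_cacti_decompose:
  assumes V: "finite V" and r: "r \<in> V" and s: "s \<in> V" and rs: "r \<noteq> s"
  shows "card (cacti V) =
    (\<Sum>K\<in>{K. K \<subseteq> V - {r} \<and> s \<in> K}. card (cacti (V - K)) *
       (card K * card (cacti K) +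
        (\<Sum>U\<in>{U. U \<subseteq> K \<and> s \<in> U}. card U * card (cacti U) * (card (K - U) * card (cacti (K - U))))))"
proof -
  let ?P = "{K. K \<subseteq> V - {r} \<and> s \<in> K}"
  have finP: "finite ?P" and finK: "\<And>K. K \<in> ?P \<Longrightarrow> finite K"
    using V by (auto intro: finite_subset)
  have finU: "finite {U. U \<subseteq> K \<and> s \<in> U}" if "K \<in> ?P" for K using finK[OF that] by auto
  have fin: "finite (cacti A)" if "A \<subseteq> V" for A
    using finite_cacti finite_subset[OF that V] by blast
  have eq: "cacti V = glue_edge r ` edge_data V r s \<union> glue_triangle r ` triangle_data V r s"
    using cacti_decompose[OF _ r s rs] glue_edge_props(1)[OF _ r refl]
      glue_triangle_props(1)[OF _ r refl]
    by (auto 4 3)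
  have fin_e: "finite (edge_data V r s)"
    unfolding edge_data_def
    by (intro finite_SigmaI finite_cartesian_product finP) (use finK in \<open>auto intro: fin\<close>)
  have fin_t: "finite (triangle_data V r s)"
    unfolding triangle_data_def
    by (intro finite_SigmaI finite_cartesian_product finP finU)
      (use finK in \<open>auto intro!: fin intro: finite_subset\<close>)
  have "card (cacti V) = card (edge_data V r s) + card (triangle_data V r s)"
    unfolding eq
    by (subst card_Un_disjoint)
      (simp_all add: fin_e fin_t glue_disjoint[OF r] card_image inj_on_glue_edge[OF r] inj_on_glue_triangle[OF r])
  also have "card (edge_data V r s) =
      (\<Sum>K\<in>?P. card (cacti (V - K)) * (card K * card (cacti K)))"
    unfolding edge_data_def using finP finK
    by (simp add: card_SigmaI card_cartesian_product finite_cacti V finite_subset[of _ V] fin mult_ac)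
  also have "card (triangle_data V r s) =
      (\<Sum>K\<in>?P. card (cacti (V - K)) *
        (\<Sum>U\<in>{U. U \<subseteq> K \<and> s \<in> U}. card U * card (cacti U) * (card (K - U) * card (cacti (K - U)))))"
  proof -
    define T where "T K U = (SIGMA u:U. SIGMA w:K - U. cacti (V - K) \<times> cacti U \<times> cacti (K - U))"
      for K U
    let ?Q = "\<lambda>K. {U. U \<subseteq> K \<and> s \<in> U}"
    have T: "finite (T K U)" "card (T K U) =
        card (cacti (V - K)) * (card U * card (cacti U) * (card (K - U) * card (cacti (K - U))))"
      if "K \<in> ?P" "U \<in> ?Q K" for K U
    proof -
      have "finite U" "finite (K - U)" "finite (cacti (V - K) \<times> cacti U \<times> cacti (K - U))"
        using that finK[OF that(1)] V by (auto intro!: finite_cacti intro: finite_subset)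
      then show "finite (T K U)" "card (T K U) =
        card (cacti (V - K)) * (card U * card (cacti U) * (card (K - U) * card (cacti (K - U))))"
        by (auto simp: T_def card_cartesian_product mult_ac)
    qed
    have fin: "finite (SIGMA U:?Q K. T K U)" if "K \<in> ?P" for K
      using that by (intro finite_SigmaI finU T) auto
    have "triangle_data V r s = (SIGMA K:?P. SIGMA U:?Q K. T K U)"
      by (simp add: triangle_data_def T_def)
    then have "card (triangle_data V r s) = (\<Sum>K\<in>?P. card (SIGMA U:?Q K. T K U))"
      using card_SigmaI[OF finP, of "\<lambda>K. SIGMA U:?Q K. T K U"] fin by simp
    also have "\<dots> = (\<Sum>K\<in>?P. \<Sum>U\<in>?Q K. card (T K U))"
      by (intro sum.cong refl card_SigmaI finU) (use T in auto)
    also have "\<dots> = (\<Sum>K\<in>?P. \<Sum>U\<in>?Q K. card (cacti (V - K)) *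
        (card U * card (cacti U) * (card (K - U) * card (cacti (K - U)))))"
      by (intro sum.cong refl T)
    finally show ?thesis by (simp add: sum_distrib_left)
  qed
  finally show ?thesis by (simp add: sum.distrib distrib_left)
qed

section \<open>Cacti and topological minors\<close>

definition steps :: "'a list \<Rightarrow> 'a rel" where
  "steps p = set (zip p (tl p))"

lemma steps_simps [simp]:
  "steps [] = {}" "steps [x] = {}" "steps (x # y # p) = insert (x, y) (steps (y # p))"
  by (auto simp: steps_def)

lemma steps_append:
  "xs \<noteq> [] \<Longrightarrow> ys \<noteq> [] \<Longrightarrow> steps (xs @ ys) = steps xs \<union> steps ys \<union> {(last xs, hd ys)}"
  by (induction xs rule: induct_list012) (cases ys; auto)+

lemma steps_nthE:
  assumes "(x, y) \<in> steps p"
  obtains i where "Suc i < length p" "x = p ! i" "y = p ! Suc i"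
proof -
  obtain i where "i < length p - 1" "x = p ! i" "y = tl p ! i"
    using assms by (auto simp: steps_def set_zip)
  then show thesis by (intro that[of i]) (auto simp: nth_tl)
qed

lemma steps_in_set: "(x, y) \<in> steps p \<Longrightarrow> x \<in> set p \<and> y \<in> set p"
  by (auto elim!: steps_nthE)

lemma steps_rtrancl: "p \<noteq> [] \<Longrightarrow> steps p \<subseteq> E \<Longrightarrow> (hd p, last p) \<in> E\<^sup>*"
  by (induction p rule: induct_list012) (auto intro: converse_rtrancl_into_rtrancl)

text \<open>Whenever the walk returns to a visited vertex, the path is cut back to its initial part
  ending there.\<close>

lemma rtrancl_distinct_path:
  assumes "(x, y) \<in> E\<^sup>*"
  obtains p where "p \<noteq> []" "hd p = x" "last p = y" "distinct p" "steps p \<subseteq> E"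
  using assms
proof (induction arbitrary: thesis rule: rtrancl_induct)
  case base
  show ?case by (rule base[of "[x]"]) auto
next
  case (step y z)
  obtain p where p: "p \<noteq> []" "hd p = x" "last p = y" "distinct p" "steps p \<subseteq> E"
    using step.IH by blast
  show ?case
  proof (cases "z \<in> set p")
    case True
    then obtain a b where ab: "p = a @ z # b" by (auto simp: in_set_conv_decomp)
    have "steps (a @ [z]) \<subseteq> E"
    proof (cases b)
      case (Cons c d)
      then show ?thesis using p(5) steps_append[of "a @ [z]" b] ab by auto
    qed (use p ab in auto)
    then show ?thesis
      by (intro step.prems[of "a @ [z]"]) (use p ab in \<open>auto simp: hd_append\<close>)
  next
    case False
    then show ?thesis
      by (intro step.prems[of "p @ [z]"]) (use p step.hyps in \<open>auto simp: steps_append\<close>)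
  qed
qed

text \<open>The edge closing a path to a cycle is thus no step of the path, in either direction. A
  list of two vertices is the exception, whence the length bound.\<close>

lemma steps_avoid_ends:
  assumes "distinct p" "3 \<le> length p" "(x, y) \<in> steps p"
  shows "{x, y} \<noteq> {hd p, last p}"
proof
  assume eq: "{x, y} = {hd p, last p}"
  obtain i where i: "Suc i < length p" "x = p ! i" "y = p ! Suc i" using steps_nthE[OF assms(3)] .
  have ne: "p \<noteq> []" using assms(2) by auto
  then have ends: "hd p = p ! 0" "last p = p ! (length p - 1)" by (auto simp: hd_conv_nth last_conv_nth)
  have "p ! i \<in> {p ! 0, p ! (length p - 1)}" "p ! Suc i \<in> {p ! 0, p ! (length p - 1)}"
    using eq i ends by (metis insertCI)+
  moreover have "p ! a = p ! b \<longleftrightarrow> a = b" if "a < length p" "b < length p" for a b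
    using that assms(1) by (simp add: nth_eq_iff_index_eq)
  moreover have "i < length p" "0 < length p" "length p - 1 < length p" using i(1) by auto
  ultimately have "i = 0 \<or> i = length p - 1" "Suc i = 0 \<or> Suc i = length p - 1"
    using i(1) by (metis insertE singletonD)+
  then show False using assms(2) i(1) by linarith
qed

text \<open>Cycles with at least four vertices are the subdivisions of the four-cycle, so this is
  the list form of having that graph as a topological minor.\<close>

definition long_cycle :: "'a rel \<Rightarrow> bool" where
  "long_cycle E \<longleftrightarrow>
     (\<exists>p. distinct p \<and> 4 \<le> length p \<and> steps p \<subseteq> E \<and> (last p, hd p) \<in> E)"

lemma long_cycle_mono: "long_cycle E \<Longrightarrow> E \<subseteq> F \<Longrightarrow> long_cycle F"
  unfolding long_cycle_def by blast

text \<open>An arc that is not a bridge closes a path; without long cycles this path has three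
  vertices, and the arc lies in a triangle. A detour between two triangle vertices would have
  exactly one inner vertex \<open>t\<close> and close up through the third triangle vertex to a
  cycle of length four.\<close>

lemma in_block_if_no_long_cycle:
  assumes sym: "sym E" and irrefl: "\<And>x. (x, x) \<notin> E" and no: "\<not> long_cycle E" and uv: "(u, v) \<in> E"
  shows "in_block E u v"
proof (cases "bridge E u v")
  case False
  then have "(u, v) \<in> (E - edge_arcs u v)\<^sup>*" using uv by (simp add: bridge_def)
  then obtain p where p: "p \<noteq> []" "hd p = u" "last p = v" "distinct p" "steps p \<subseteq> E - edge_arcs u v"
    by (rule rtrancl_distinct_path)
  have symE: "(y, x) \<in> E" if "(x, y) \<in> E" for x y using sym that by (auto simp: sym_def)
  have short: "length q < 4" if "distinct q" "steps q \<subseteq> E" "(last q, hd q) \<in> E" for q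
    using no that unfolding long_cycle_def by force
  have "u \<noteq> v" using uv irrefl by auto
  have "length p < 4" using short[of p] p symE uv by auto
  moreover have "length p \<noteq> 1" using p \<open>u \<noteq> v\<close> by (auto simp: length_Suc_conv)
  moreover have "length p \<noteq> 2" using p by (auto simp: length_Suc_conv numeral_2_eq_2 edge_arcs_def)
  moreover have "length p \<noteq> 0" using p by simp
  ultimately have "length p = Suc (Suc (Suc 0))" by linarith
  then obtain w where w: "p = [u, w, v]" using p by (auto simp: length_Suc_conv)
  have E: "(u, w) \<in> E" "(w, v) \<in> E" "u \<noteq> w" "v \<noteq> w" using p w by auto
  have D: "tri_arcs u v w \<subseteq> E" using E uv symE by (auto simp: tri_arcs_def)
  have sep: "(x, y) \<notin> (E - tri_arcs u v w)\<^sup>*"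
    if xyz: "x \<noteq> y" "x \<noteq> z" "y \<noteq> z" "{x, y, z} = {u, v, w}" for x y z
  proof
    have "x \<in> {u, v, w}" "y \<in> {u, v, w}" "z \<in> {u, v, w}" using xyz(4) by blast+
    then have T: "(x, y) \<in> tri_arcs u v w" "(x, z) \<in> tri_arcs u v w" "(y, z) \<in> tri_arcs u v w" "(z, x) \<in> tri_arcs u v w"
      using xyz(1-3) by (auto simp: tri_arcs_def)
    assume "(x, y) \<in> (E - tri_arcs u v w)\<^sup>*"
    then obtain q where q: "q \<noteq> []" "hd q = x" "last q = y" "distinct q" "steps q \<subseteq> E - tri_arcs u v w"
      by (rule rtrancl_distinct_path)
    have "length q < 4" using short[of q] q T D symE by blast
    moreover have "length q \<noteq> 1" using q xyz by (auto simp: length_Suc_conv)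
    moreover have "length q \<noteq> 2" using q T by (auto simp: length_Suc_conv numeral_2_eq_2)
    moreover have "length q \<noteq> 0" using q by simp
    ultimately have "length q = Suc (Suc (Suc 0))" by linarith
    then obtain t where t: "q = [x, t, y]" using q by (auto simp: length_Suc_conv)
    have "z \<noteq> t" using q T t by auto
    then have "length [x, t, y, z] < 4"
      using q t xyz T D by (intro short) auto
    then show False by simp
  qed
  have "tri_block E u v w"
    unfolding tri_block_def
    using D sep[of u v w] sep[of u w v] sep[of v w u] E \<open>u \<noteq> v\<close> by (auto simp: insert_commute)
  then show ?thesis by (auto simp: in_block_def)
qed (simp add: in_block_def)

text \<open>In use, \<open>D\<close> is the triangle on \<open>c\<close> and the two ends of the
  path. Its arcs touch \<open>c\<close>, which is off the path, or join the ends, which are not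
  consecutive.\<close>

lemma path_avoids_triangle:
  assumes "distinct p" "3 \<le> length p" "steps p \<subseteq> E" "c \<notin> set p"
    and D: "\<And>x y. (x, y) \<in> D \<Longrightarrow> x = c \<or> y = c \<or> {x, y} = {hd p, last p}"
  shows "(hd p, last p) \<in> (E - D)\<^sup>*"
proof (rule steps_rtrancl)
  show "steps p \<subseteq> E - D"
  proof
    fix e assume e: "e \<in> steps p"
    obtain x y where xy: "e = (x, y)" by (cases e)
    have "e \<notin> D" using e D[of x y] steps_in_set[of x y p] steps_avoid_ends[OF assms(1,2), of x y] assms(4) xy by auto
    then show "e \<in> E - D" using e assms(3) by auto
  qed
qed (use assms in auto)

text \<open>Let \<open>(u, v)\<close> close the cycle. If it is a bridge, the rest of the cycle is a
  detour. If it lies in a triangle with third vertex \<open>w\<close>, either \<open>w\<close> is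
  off the cycle and the rest is a detour around the triangle, or \<open>w\<close> cuts the rest into
  two paths, one of which is such a detour.\<close>

lemma no_long_cycle_if_in_block:
  assumes sym: "sym E" and blk: "\<And>u v. (u, v) \<in> E \<Longrightarrow> in_block E u v"
  shows "\<not> long_cycle E"
proof
  assume "long_cycle E"
  then obtain p where p: "distinct p" "4 \<le> length p" "steps p \<subseteq> E" "(last p, hd p) \<in> E"
    unfolding long_cycle_def by auto
  define u v where "u = last p" and "v = hd p"
  have ne: "p \<noteq> []" using p by auto
  have uv: "(u, v) \<in> E" using p by (simp add: u_def v_def)
  from blk[OF uv] consider "bridge E u v" | w where "tri_block E u v w"
    unfolding in_block_def by auto
  then show False
  proof cases
    case 1
    have "steps p \<subseteq> E - edge_arcs u v"
      using p steps_avoid_ends[of p] by (auto simp: edge_arcs_def u_def v_def)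
    then have "(v, u) \<in> (E - edge_arcs u v)\<^sup>*"
      unfolding u_def v_def by (rule steps_rtrancl[OF ne])
    moreover have "sym (E - edge_arcs u v)" using sym by (auto simp: sym_def edge_arcs_def)
    ultimately have "(u, v) \<in> (E - edge_arcs u v)\<^sup>*" by (metis sym_rtranclD)
    then show False using 1 by (simp add: bridge_def)
  next
    case 2
    let ?D = "tri_arcs u v w"
    have symD: "sym (E - ?D)" using sym by (auto simp: sym_def tri_arcs_def)
    have no: "(v, u) \<notin> (E - ?D)\<^sup>*" "(v, w) \<notin> (E - ?D)\<^sup>*" "(w, u) \<notin> (E - ?D)\<^sup>*"
      using 2 sym_rtranclD[OF symD] unfolding tri_block_def by blast+
    have "w \<in> set p"
    proof (rule ccontr)
      assume w: "w \<notin> set p"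
      have "(hd p, last p) \<in> (E - ?D)\<^sup>*"
        by (rule path_avoids_triangle[OF p(1) _ p(3) w])
          (use p(2) in \<open>auto simp: u_def v_def tri_arcs_def\<close>)
      then show False using no(1) by (simp add: u_def v_def)
    qed
    then obtain a b where ab: "p = a @ w # b" by (auto simp: in_set_conv_decomp)
    have nw: "u \<noteq> w" "v \<noteq> w" "u \<noteq> v" using tri_block_neq[OF 2] by auto
    have "b \<noteq> []" using ab nw(1) by (auto simp: u_def)
    have "a \<noteq> []" using ab nw(2) by (auto simp: v_def)
    have ends: "hd (a @ [w]) = v" "last (w # b) = u"
      using ab \<open>a \<noteq> []\<close> \<open>b \<noteq> []\<close> by (auto simp: u_def v_def)
    have un: "u \<in> set b" "v \<in> set a"
      using ab \<open>a \<noteq> []\<close> \<open>b \<noteq> []\<close> by (auto simp: u_def v_def)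
    have st1: "steps (a @ [w]) \<subseteq> E" using p(3) ab steps_append[of "a @ [w]" b] \<open>b \<noteq> []\<close> by auto
    have st2: "steps (w # b) \<subseteq> E" using p(3) ab steps_append[of a "w # b"] \<open>a \<noteq> []\<close> by auto
    \<comment> \<open>The two paths share \<open>w\<close>, so together they count at least five
      vertices.\<close>
    have "3 \<le> length (a @ [w]) \<or> 3 \<le> length (w # b)" using p(2) ab by auto
    then show False
    proof
      assume len: "3 \<le> length (a @ [w])"
      have "(hd (a @ [w]), last (a @ [w])) \<in> (E - ?D)\<^sup>*"
        by (rule path_avoids_triangle[OF _ len st1, of u])
          (use p(1) ab un nw ends(1) in \<open>auto simp: tri_arcs_def\<close>)
      then show False using no(2) ends by simp
    next
      assume len: "3 \<le> length (w # b)"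
      have "(hd (w # b), last (w # b)) \<in> (E - ?D)\<^sup>*"
        by (rule path_avoids_triangle[OF _ len st2, of v])
          (use p(1) ab un nw ends(2) in \<open>auto simp: tri_arcs_def\<close>)
      then show False using no(3) ends by simp
    qed
  qed
qed

text \<open>A cycle that misses the subdivided edge survives. Otherwise it is rotated until that
  edge is the closing one, and \<open>w\<close> is put in front of the list.\<close>

lemma long_cycle_subdivide:
  assumes E: "E \<subseteq> V \<times> V" "sym E" and w: "w \<notin> V" and lc: "long_cycle E"
  shows "long_cycle (E - {(u, v), (v, u)} \<union> {(u, w), (w, u), (w, v), (v, w)})" (is "long_cycle ?E'")
proof -
  let ?D = "{(u, v), (v, u)}"
  obtain p where p: "distinct p" "4 \<le> length p" "steps p \<subseteq> E" "(last p, hd p) \<in> E"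
    using lc unfolding long_cycle_def by auto
  have closing: ?thesis
    if q: "distinct q" "4 \<le> length q" "steps q \<subseteq> E" "(last q, hd q) \<in> ?D" "set q \<subseteq> V" for q
  proof -
    have eq: "{hd q, last q} = {u, v}" using q(4) by auto
    have "(x, y) \<notin> ?D" if "(x, y) \<in> steps q" for x y
      using steps_avoid_ends[OF q(1) _ that] q(2) unfolding eq by auto
    then have "steps q \<subseteq> ?E'" using q(3) by auto
    moreover obtain x xs where "q = x # xs" using q(2) by (cases q) auto
    ultimately have "distinct (w # q) \<and> 4 \<le> length (w # q) \<and> steps (w # q) \<subseteq> ?E' \<and>
        (last (w # q), hd (w # q)) \<in> ?E'"
      using q w by auto
    then show ?thesis unfolding long_cycle_def by blast
  qed
  have "set p \<subseteq> V"
  proof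
    fix x assume "x \<in> set p"
    then obtain i where i: "i < length p" "x = p ! i" by (auto simp: in_set_conv_nth)
    show "x \<in> V"
    proof (cases "Suc i < length p")
      case True
      then have "(x, p ! Suc i) \<in> steps p" using i by (force simp: steps_def set_zip nth_tl)
      then show ?thesis using p(3) E by auto
    next
      case False
      then have "i = length p - 1" "p \<noteq> []" using i by auto
      then have "x = last p" using i by (simp add: last_conv_nth)
      then show ?thesis using p(4) E by auto
    qed
  qed
  show ?thesis
  proof (cases "(last p, hd p) \<in> ?D")
    case True
    then show ?thesis using closing[of p] p \<open>set p \<subseteq> V\<close> by blast
  next
    case outer: False
    show ?thesis
    proof (cases "steps p \<inter> ?D = {}")
      case True
      then have "steps p \<subseteq> ?E'" "(last p, hd p) \<in> ?E'" using p outer by auto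
      then show ?thesis using p unfolding long_cycle_def by blast
    next
      case False
      then obtain x y where xy: "(x, y) \<in> steps p" "(x, y) \<in> ?D" by auto
      obtain i where i: "Suc i < length p" "x = p ! i" "y = p ! Suc i" using steps_nthE[OF xy(1)] .
      \<comment> \<open>Swapping the two pieces makes \<open>(x, y)\<close> the closing arc; the
        former closing arc joins the pieces.\<close>
      let ?a = "take (Suc i) p" and ?b = "drop (Suc i) p"
      have "p \<noteq> []" using i by auto
      then have ab: "?a \<noteq> []" "?b \<noteq> []" "last ?a = x" "hd ?b = y" "hd ?a = hd p" "last ?b = last p"
        using i by (auto simp: hd_drop_conv_nth take_Suc_conv_app_nth hd_append hd_conv_nth)
      have "steps p = steps ?a \<union> steps ?b \<union> {(last ?a, hd ?b)}"
        using steps_append[OF ab(1,2)] by simp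
      then have "steps (?b @ ?a) \<subseteq> E"
        using steps_append[OF ab(2,1)] p(3,4) ab by auto
      moreover have "distinct (?b @ ?a)"
        using p(1) set_take_disj_set_drop_if_distinct[of p "Suc i" "Suc i"] by auto
      moreover have "(last (?b @ ?a), hd (?b @ ?a)) \<in> ?D" using xy ab by simp
      moreover have "4 \<le> length (?b @ ?a)" using p(2) i by auto
      moreover have "set (?b @ ?a) \<subseteq> V" using \<open>set p \<subseteq> V\<close> set_take_subset set_drop_subset by fastforce
      ultimately show ?thesis by (intro closing)
    qed
  qed
qed

section \<open>Long cycles as subdivisions of the four-cycle\<close>

definition cycle_on :: "'a list \<Rightarrow> 'a pair_pre_digraph" where
  "cycle_on p = \<lparr>pverts = set p, parcs = steps (p @ [hd p]) \<union> (steps (p @ [hd p]))\<inverse>\<rparr>"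

lemma cycle_on_bidirected:
  assumes "distinct p" "2 \<le> length p"
  shows "pair_bidirected_digraph (cycle_on p)"
proof -
  have ne: "p \<noteq> []" using assms by auto
  have irrefl: "x \<noteq> y" if xy: "(x, y) \<in> steps (p @ [hd p])" for x y
  proof -
    consider "(x, y) \<in> steps p" | "x = last p" "y = hd p"
      using xy steps_append[OF ne, of "[hd p]"] by auto
    then show ?thesis
    proof cases
      case 1
      then show ?thesis using assms(1) by (auto elim!: steps_nthE simp: nth_eq_iff_index_eq)
    next
      case 2
      then show ?thesis using assms by (cases p) auto
    qed
  qed
  have "(x, x) \<notin> steps (p @ [hd p])" for x using irrefl by blast
  moreover have "x \<in> set p \<and> y \<in> set p" if "(x, y) \<in> steps (p @ [hd p])" for x y
    using steps_in_set[OF that] ne by auto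
  ultimately show ?thesis
    by unfold_locales (auto simp: cycle_on_def symmetric_def sym_def)
qed

lemma cycle_on_4:
  assumes "distinct [a, b, c, d]"
  shows "digraph_iso (with_proj (cycle_graph 4)) (with_proj (cycle_on [a, b, c, d]))"
proof -
  let ?f = "\<lambda>i. [a, b, c, d] ! i"
  let ?h = "\<lparr>iso_verts = ?f, iso_arcs = map_prod ?f ?f, iso_head = snd, iso_tail = fst\<rparr>"
  have V: "{0..<4::nat} = {0, 1, 2, 3}" by auto
  have A: "parcs (cycle_graph 4) =
      {(0, 1), (1, 0), (1, 2), (2, 1), (2, 3), (3, 2), (3, 0), (0, 3)}"
  proof -
    have "(i, j) \<in> parcs (cycle_graph 4) \<longleftrightarrow>
        (i, j) \<in> {(0, 1), (1, 0), (1, 2), (2, 1), (2, 3), (3, 2), (3, 0), (0, 3)}" for i j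
    proof (cases "i < 4 \<and> j < 4")
      case True
      then have "i = 0 \<or> i = 1 \<or> i = 2 \<or> i = 3" "j = 0 \<or> j = 1 \<or> j = 2 \<or> j = 3" by arith+
      then show ?thesis by (elim disjE) (simp_all add: cycle_graph_def)
    qed (auto simp: cycle_graph_def)
    then show ?thesis by (simp add: set_eq_iff split_paired_all)
  qed
  have inj: "inj_on ?f {0..<4}"
    using assms by (intro inj_on_nth) auto
  have sub: "parcs (cycle_graph 4) \<subseteq> {0..<4} \<times> {0..<4}" by (auto simp: cycle_graph_def)
  have "inj_on (map_prod ?f ?f) (parcs (cycle_graph 4))"
    by (rule inj_on_subset[OF map_prod_inj_on[OF inj inj] sub])
  moreover have "wf_digraph (with_proj (cycle_graph 4))"
    by unfold_locales (auto simp: cycle_graph_def)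
  ultimately have iso: "pre_digraph.digraph_isomorphism (with_proj (cycle_graph 4)) ?h"
    using inj by (simp add: pre_digraph.digraph_isomorphism_def cycle_graph_def)
  have "with_proj (cycle_on [a, b, c, d]) = app_iso ?h (with_proj (cycle_graph 4))"
  proof -
    have "?f ` pverts (cycle_graph 4) = set [a, b, c, d]"
      by (simp add: cycle_graph_def V numeral_2_eq_2 numeral_3_eq_3)
    moreover have "map_prod ?f ?f ` parcs (cycle_graph 4) = parcs (cycle_on [a, b, c, d])"
      unfolding A by (auto simp: cycle_on_def numeral_2_eq_2 numeral_3_eq_3)
    ultimately show ?thesis
      by (simp add: app_iso_def with_proj_def cycle_on_def)
  qed
  then show ?thesis unfolding digraph_iso_def using iso by blast
qed

text \<open>The rest of the cycle is a path from \<open>y\<close> back to \<open>x\<close> with more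
  than two vertices, so it contains neither direction of the subdivided edge and only that edge is
  replaced.\<close>

lemma cycle_on_subdivide:
  assumes "distinct (x # w # y # zs)" "2 \<le> length zs"
  shows "cycle_on (x # w # y # zs) = subdivide (cycle_on (x # y # zs)) (x, y) w"
proof -
  let ?L = "steps (y # zs @ [x])"
  have L: "(x, y) \<notin> ?L" "(y, x) \<notin> ?L"
    using steps_avoid_ends[of "y # zs @ [x]"] assms by fastforce+
  show ?thesis
    using L by (auto simp: cycle_on_def subdivide.simps)
qed

text \<open>Dropping the second vertex of a cycle with more than four vertices gives a shorter
  cycle, and subdividing its first edge puts that vertex back. With four vertices, \<open>K\<close>
  is the cycle itself.\<close>

lemma cycle_subdivision:
  assumes "distinct p" "4 \<le> length p"
  shows "\<exists>K. digraph_iso (with_proj (cycle_graph 4)) (with_proj K) \<and> subdivision_pair K (cycle_on p)"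
  using assms
proof (induction "length p" arbitrary: p rule: less_induct)
  case less
  obtain x w y z zs where p: "p = x # w # y # z # zs"
    using less.prems(2) by (auto simp: numeral_eq_Suc Suc_le_length_iff)
  show ?case
  proof (cases "zs = []")
    case True
    then show ?thesis
      using cycle_on_4[of x w y z] less.prems p cycle_on_bidirected[of p]
        subdivision_pair_base[of "cycle_on p"] by auto
  next
    case False
    let ?q = "x # y # z # zs"
    have "distinct ?q" "4 \<le> length ?q" "length ?q < length p"
      using less.prems p False by (auto simp: Suc_le_eq)
    then obtain K where K: "digraph_iso (with_proj (cycle_graph 4)) (with_proj K)"
      "subdivision_pair K (cycle_on ?q)"
      using less.hyps by blast
    have "cycle_on p = subdivide (cycle_on ?q) (x, y) w"
      unfolding p using less.prems p False by (intro cycle_on_subdivide) (auto simp: Suc_le_eq)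
    moreover have "subdivision_pair K (subdivide (cycle_on ?q) (x, y) w)"
      by (rule subdivision_pair_divide[OF _ _ K(2)])
        (use less.prems p in \<open>auto simp: cycle_on_def\<close>)
    ultimately show ?thesis using K(1) by auto
  qed
qed

lemma topological_minor_if_long_cycle:
  assumes G: "pair_graph G" and lc: "long_cycle (parcs G)"
  shows "topological_minor (cycle_graph 4) G"
proof -
  interpret pair_graph G by fact
  obtain p where p: "distinct p" "4 \<le> length p" "steps p \<subseteq> parcs G" "(last p, hd p) \<in> parcs G"
    using lc unfolding long_cycle_def by auto
  have ne: "p \<noteq> []" using p by auto
  obtain K where K: "digraph_iso (with_proj (cycle_graph 4)) (with_proj K)"
    "subdivision_pair K (cycle_on p)"
    using cycle_subdivision[OF p(1,2)] by blast
  have st: "steps (p @ [hd p]) \<subseteq> parcs G" using p steps_append[OF ne, of "[hd p]"] by auto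
  then have arcs: "parcs (cycle_on p) \<subseteq> parcs G"
    unfolding cycle_on_def pair_pre_digraph.simps using arcs_symmetric by blast
  have "x \<in> pverts G" if x: "x \<in> set p" for x
  proof -
    obtain a b where "p = a @ x # b" using x by (auto simp: in_set_conv_decomp)
    then have "steps (p @ [hd p]) = steps (a @ (x # (b @ [hd p])))" by simp
    then have "(x, hd (b @ [hd p])) \<in> steps (p @ [hd p])"
      by (cases "a = []"; cases b) (auto simp: steps_append)
    then show ?thesis using st in_arcsD1 by blast
  qed
  then have "pverts (cycle_on p) \<subseteq> pverts G" by (auto simp: cycle_on_def)
  moreover have "pair_bidirected_digraph (cycle_on p)" using p by (intro cycle_on_bidirected) auto
  then interpret S: pair_bidirected_digraph "cycle_on p" .
  have "wf_digraph (with_proj (cycle_on p))" "wf_digraph (with_proj G)" by unfold_locales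
  ultimately have "subgraph (with_proj (cycle_on p)) (with_proj G)"
    using arcs by (auto simp: subgraph_def)
  then show ?thesis unfolding topological_minor_def using K by blast
qed

text \<open>The isomorphic copy \<open>K\<close> of the four-cycle has a long cycle; each
  subdivision step preserves one, and so does passing to a larger graph.\<close>

lemma long_cycle_if_topological_minor:
  assumes "topological_minor (cycle_graph 4) G"
  shows "long_cycle (parcs G)"
proof -
  obtain K S where iso: "digraph_iso (with_proj (cycle_graph 4)) (with_proj K)"
    and sd: "subdivision_pair K S" and sub: "subgraph (with_proj S) (with_proj G)"
    using assms unfolding topological_minor_def by blast
  have "long_cycle (parcs K)"
  proof -
    obtain h where h: "pre_digraph.digraph_isomorphism (with_proj (cycle_graph 4)) h"
      "with_proj K = app_iso h (with_proj (cycle_graph 4))"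
      using iso unfolding digraph_iso_def by blast
    let ?f = "iso_verts h"
    have K: "parcs K = iso_arcs h ` parcs (cycle_graph 4)" "iso_tail h = fst" "iso_head h = snd"
      using h(2) by (simp_all add: app_iso_def with_proj_def)
    have f: "inj_on ?f {0..<4}"
      using h(1) by (simp add: pre_digraph.digraph_isomorphism_def cycle_graph_def)
    \<comment> \<open>An isomorphism carries its own arc map. As tail and head in \<open>K\<close>
      are the projections, this map must act on an arc through its two ends.\<close>
    have "iso_arcs h a = (?f (fst a), ?f (snd a))" if "a \<in> parcs (cycle_graph 4)" for a
      using h(1) that unfolding pre_digraph.digraph_isomorphism_def K(2,3)
      by (simp add: prod_eq_iff)
    then have "(?f i, ?f j) \<in> parcs K" if "(i, j) \<in> parcs (cycle_graph 4)" for i j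
      using that unfolding K(1) by force
    moreover have "(0, 1) \<in> parcs (cycle_graph 4)" "(1, 2) \<in> parcs (cycle_graph 4)"
      "(2, 3) \<in> parcs (cycle_graph 4)" "(3, 0) \<in> parcs (cycle_graph 4)"
      by (auto simp: cycle_graph_def)
    ultimately have "steps [?f 0, ?f 1, ?f 2, ?f 3] \<subseteq> parcs K"
      "(last [?f 0, ?f 1, ?f 2, ?f 3], hd [?f 0, ?f 1, ?f 2, ?f 3]) \<in> parcs K"
      by auto
    moreover have "distinct [?f 0, ?f 1, ?f 2, ?f 3]"
      using inj_on_eq_iff[OF f] by auto
    ultimately show ?thesis unfolding long_cycle_def by (intro exI[of _ "[?f 0, ?f 1, ?f 2, ?f 3]"]) simp
  qed
  with sd have "long_cycle (parcs S)"
  proof (induction rule: subdivision_pair_induct)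
    case (divide e w H)
    interpret pair_bidirected_digraph H
      by (rule bidirected_digraphI_subdivision[OF divide.hyps(3)])
    obtain u v where e: "e = (u, v)" by (cases e)
    have "parcs H \<subseteq> pverts H \<times> pverts H" using wellformed' by auto
    moreover have "sym (parcs H)" by (rule symI) (rule arcs_symmetric)
    ultimately show ?case
      using long_cycle_subdivide[of "parcs H" "pverts H" w u v] divide
      by (simp add: e subdivide.simps)
  qed
  then show ?thesis
    using sub by (auto simp: subgraph_def intro: long_cycle_mono)
qed

section \<open>From library digraphs to relations\<close>

lemma pair_graph_iff:
  "pair_graph G \<longleftrightarrow> finite (pverts G) \<and> parcs G \<subseteq> pverts G \<times> pverts G \<and> sym (parcs G) \<and>
     (\<forall>x. (x, x) \<notin> parcs G)"
proof
  assume "pair_graph G"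
  then interpret pair_graph G .
  have "(x, x) \<notin> parcs G" for x using no_loops' by blast
  then show "finite (pverts G) \<and> parcs G \<subseteq> pverts G \<times> pverts G \<and> sym (parcs G) \<and> (\<forall>x. (x, x) \<notin> parcs G)"
    using pair_finite_verts in_arcsD1 in_arcsD2 arcs_symmetric by (auto simp: sym_def)
next
  assume G: "finite (pverts G) \<and> parcs G \<subseteq> pverts G \<times> pverts G \<and> sym (parcs G) \<and>
     (\<forall>x. (x, x) \<notin> parcs G)"
  then have "finite (parcs G)" using finite_subset by blast
  then show "pair_graph G"
    using G by unfold_locales (auto simp: symmetric_def)
qed

lemma reachable_with_proj_iff:
  assumes "parcs G \<subseteq> pverts G \<times> pverts G"
  shows "u \<rightarrow>\<^sup>*\<^bsub>with_proj G\<^esub> v \<longleftrightarrow> u \<in> pverts G \<and> (u, v) \<in> (parcs G)\<^sup>*"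
proof
  assume "u \<rightarrow>\<^sup>*\<^bsub>with_proj G\<^esub> v"
  then show "u \<in> pverts G \<and> (u, v) \<in> (parcs G)\<^sup>*"
    unfolding reachable_def by (auto dest: rtrancl_on_rtranclI in_rtrancl_on_in_F)
next
  assume uv: "u \<in> pverts G \<and> (u, v) \<in> (parcs G)\<^sup>*"
  then have "v \<in> pverts G" using rtrancl_closed[of u v "parcs G" "pverts G"] assms by auto
  then show "u \<rightarrow>\<^sup>*\<^bsub>with_proj G\<^esub> v"
    unfolding reachable_def using uv assms by (auto intro!: rtrancl_consistent_rtrancl_on)
qed

lemma connected_with_proj_iff:
  assumes "pair_graph G"
  shows "Digraph_Component.connected (with_proj G) \<longleftrightarrow>
    pverts G \<noteq> {} \<and> pverts G \<times> pverts G \<subseteq> (parcs G)\<^sup>*"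
proof -
  have G: "parcs G \<subseteq> pverts G \<times> pverts G" "sym (parcs G)"
    using assms by (auto simp: pair_graph_iff)
  \<comment> \<open>\<open>connected\<close> is strong connectedness of the symmetric closure, which
    changes nothing here.\<close>
  have "mk_symmetric (with_proj G) = G"
    using G(2) by (intro pair_pre_digraph.equality) (auto simp: mk_symmetric_def sym_def)
  then show ?thesis
    using G(1) by (auto simp: connected_def strongly_connected_def reachable_with_proj_iff)
qed

text \<open>Both directions pass through the absence of a long cycle. Connectedness demands a
  nonempty vertex set, so the empty cactus is excluded; \<open>egf\<close> and
  \<open>cactus_number\<close> agree only from index 1 on.\<close>

lemma Forb_C4_iff:
  "G \<in> Forb (cycle_graph 4) \<longleftrightarrow>
     finite (pverts G) \<and> pverts G \<noteq> {} \<and> parcs G \<in> cacti (pverts G)"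
proof
  assume "G \<in> Forb (cycle_graph 4)"
  then have G: "pair_graph G" "Digraph_Component.connected (with_proj G)"
    "\<not> topological_minor (cycle_graph 4) G"
    by (auto simp: Forb_def)
  then show "finite (pverts G) \<and> pverts G \<noteq> {} \<and> parcs G \<in> cacti (pverts G)"
    using G(1)[unfolded pair_graph_iff] connected_with_proj_iff[OF G(1)]
      topological_minor_if_long_cycle[OF G(1)]
    by (auto intro!: cactiI in_block_if_no_long_cycle)
next
  assume G: "finite (pverts G) \<and> pverts G \<noteq> {} \<and> parcs G \<in> cacti (pverts G)"
  then have c: "parcs G \<in> cacti (pverts G)" by simp
  have pg: "pair_graph G"
    using G cacti_subset[OF c] cacti_sym[OF c] cacti_irrefl[OF c] by (simp add: pair_graph_iff)
  moreover have "Digraph_Component.connected (with_proj G)"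
    using G cacti_connected[OF c] by (auto simp: connected_with_proj_iff[OF pg])
  moreover have "\<not> topological_minor (cycle_graph 4) G"
    using no_long_cycle_if_in_block[OF cacti_sym[OF c] cacti_in_block[OF c]]
      long_cycle_if_topological_minor by blast
  ultimately show "G \<in> Forb (cycle_graph 4)" by (simp add: Forb_def)
qed

section \<open>Counting cacti\<close>

text \<open>Relabelling carries blocks to blocks, since a detour in the image is pulled back along
  \<open>inv_into V f\<close> to one in \<open>E\<close>.\<close>

lemma cacti_image:
  assumes f: "inj_on f V" and E: "E \<in> cacti V"
  shows "map_prod f f ` E \<in> cacti (f ` V)"
proof (rule cactiI)
  note sub = cacti_subset[OF E]
  let ?E = "map_prod f f ` E"
  show "?E \<subseteq> f ` V \<times> f ` V" using sub by auto
  show "sym ?E" using cacti_sym[OF E] by (force simp: sym_def)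
  show "(x, y) \<in> ?E\<^sup>*" if xy: "x \<in> f ` V" "y \<in> f ` V" for x y
  proof -
    obtain a b where ab: "a \<in> V" "b \<in> V" "x = f a" "y = f b" using xy by auto
    show ?thesis
      unfolding ab(3,4) by (rule rtrancl_retract[OF cacti_connected[OF E ab(1,2)]]) force
  qed
  fix x y assume "(x, y) \<in> ?E"
  then obtain u v where uv: "(u, v) \<in> E" "x = f u" "y = f v" by auto
  have V: "u \<in> V" "v \<in> V" using uv sub by auto
  have pull: "(p, q) \<in> (E - D)\<^sup>*"
    if "(f p, f q) \<in> (?E - map_prod f f ` D)\<^sup>*" "p \<in> V" "q \<in> V" for p q D
  proof -
    have "(inv_into V f (f p), inv_into V f (f q)) \<in> (E - D)\<^sup>*"
    proof (rule rtrancl_retract[OF that(1)])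
      fix a b assume "(a, b) \<in> ?E - map_prod f f ` D"
      then obtain a' b' where ab: "(a', b') \<in> E" "(a', b') \<notin> D" "a = f a'" "b = f b'" by force
      then have "a' \<in> V" "b' \<in> V" using sub by auto
      then show "inv_into V f a = inv_into V f b \<or> (inv_into V f a, inv_into V f b) \<in> E - D"
        using ab f by simp
    qed
    then show ?thesis using f that by simp
  qed
  from cacti_in_block[OF E uv(1)] consider "bridge E u v" | w where "tri_block E u v w"
    unfolding in_block_def by auto
  then show "in_block ?E x y"
  proof cases
    case 1
    have "edge_arcs x y = map_prod f f ` edge_arcs u v" by (simp add: uv edge_arcs_def)
    then have "bridge ?E x y" using 1 pull[of u v "edge_arcs u v"] uv V by (auto simp: bridge_def)
    then show ?thesis by (simp add: in_block_def)
  next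
    case 2
    have D: "tri_arcs x y (f w) = map_prod f f ` tri_arcs u v w" by (simp add: uv tri_arcs_def)
    have "(u, w) \<in> E" using 2 by (auto simp: tri_block_def tri_arcs_def)
    then have "w \<in> V" using sub by auto
    then have "tri_block ?E x y (f w)"
      using 2 pull[of _ _ "tri_arcs u v w"] V unfolding tri_block_def D unfolding uv(2,3) by blast
    then show ?thesis by (auto simp: in_block_def)
  qed
qed

text \<open>Used in both directions to show that the number depends on \<open>card V\<close> only,
  even across vertex types.\<close>

lemma card_cacti_le:
  fixes V :: "'a set" and W :: "'b set"
  assumes "finite V" "finite W" "card V = card W"
  shows "card (cacti V) \<le> card (cacti W)"
proof -
  obtain f where f: "bij_betw f V W" using finite_same_card_bij[OF assms] by auto
  then have inj: "inj_on f V" and W: "f ` V = W" by (auto simp: bij_betw_def)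
  have "inj_on (map_prod f f) (V \<times> V)" using inj by (rule map_prod_inj_on[OF _ inj])
  then have "inj_on (image (map_prod f f)) (cacti V)"
    by (intro inj_onI) (metis cacti_subset inj_on_image_eq_iff)
  moreover have "image (map_prod f f) ` cacti V \<subseteq> cacti W"
    using cacti_image[OF inj] W by auto
  ultimately show ?thesis using finite_cacti[OF assms(2)] by (intro card_inj_on_le)
qed

section \<open>The recursion for the number of cacti\<close>

definition cactus_number :: "nat \<Rightarrow> nat" where
  "cactus_number n = card (cacti {..<n})"

lemma card_cacti: "finite V \<Longrightarrow> card (cacti V) = cactus_number (card V)"
  unfolding cactus_number_def by (intro antisym card_cacti_le) auto

lemma cactus_number_1: "cactus_number (Suc 0) = 1"
proof -
  have "cacti {..<Suc 0} = {{}}"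
  proof
    show "cacti {..<Suc 0} \<subseteq> {{}}" using cacti_subset cacti_irrefl by fastforce
    show "{{}} \<subseteq> cacti {..<Suc 0}" by (auto intro!: cactiI simp: sym_def)
  qed
  then show ?thesis by (simp add: cactus_number_def)
qed

lemma sum_Pow_card:
  fixes g :: "nat \<Rightarrow> nat"
  assumes "finite A"
  shows "(\<Sum>U\<in>Pow A. g (card U)) = (\<Sum>k\<le>card A. (card A choose k) * g k)"
proof -
  have "(\<Sum>U\<in>Pow A. g (card U)) = (\<Sum>k\<le>card A. \<Sum>U\<in>{U \<in> Pow A. card U = k}. g (card U))"
    by (rule sum.group[symmetric]) (use assms card_mono in auto)
  also have "\<dots> = (\<Sum>k\<le>card A. (card A choose k) * g k)"
    by (intro sum.cong refl) (simp add: n_subsets[OF assms])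
  finally show ?thesis .
qed

lemma sum_subsets_containing:
  fixes g :: "nat \<Rightarrow> nat"
  assumes "finite V" "s \<in> V" "card V = Suc n"
  shows "(\<Sum>U\<in>{U. U \<subseteq> V \<and> s \<in> U}. g (card U)) = (\<Sum>k\<le>n. (n choose k) * g (Suc k))"
proof -
  have "bij_betw (insert s) (Pow (V - {s})) {U. U \<subseteq> V \<and> s \<in> U}"
    by (rule bij_betw_byWitness[where f' = "\<lambda>U. U - {s}"]) (use assms in auto)
  then have "(\<Sum>U\<in>{U. U \<subseteq> V \<and> s \<in> U}. g (card U)) = (\<Sum>U\<in>Pow (V - {s}). g (card (insert s U)))"
    by (rule sum.reindex_bij_betw[symmetric])
  also have "\<dots> = (\<Sum>U\<in>Pow (V - {s}). g (Suc (card U)))"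
  proof (intro sum.cong refl)
    fix U assume "U \<in> Pow (V - {s})"
    then have "finite U" "s \<notin> U" using assms(1) by (auto intro: finite_subset)
    then show "g (card (insert s U)) = g (Suc (card U))" by simp
  qed
  also have "\<dots> = (\<Sum>k\<le>n. (n choose k) * g (Suc k))"
    using sum_Pow_card[of "V - {s}" "\<lambda>k. g (Suc k)"] assms by simp
  finally show ?thesis .
qed

text \<open>The decomposition with \<open>r = 0\<close> and \<open>s = 1\<close>, where
  \<open>k = card K - 1\<close> and \<open>j = card U - 1\<close>; \<open>t\<close> counts rooted
  cacti. The inner term \<open>j = k\<close> vanishes by \<open>t 0 = 0\<close>, in accordance with
  \<open>U\<close> being a proper subset of \<open>K\<close>.\<close>

lemma cactus_number_rec:
  fixes c t :: "nat \<Rightarrow> nat"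
  defines "c \<equiv> cactus_number" and "t \<equiv> \<lambda>n. n * cactus_number n"
  shows "c (n + 2) =
    (\<Sum>k\<le>n. (n choose k) * (c (Suc (n - k)) * (t (Suc k) + (\<Sum>j\<le>k. (k choose j) * (t (Suc j) * t (k - j))))))"
proof -
  let ?V = "{..<n + 2}"
  \<comment> \<open>The ways to hang a far side with \<open>m\<close> vertices on \<open>r\<close>,
    by a bridge or by a triangle.\<close>
  define q where "q m = t m + (\<Sum>j\<le>m - 1. (m - 1 choose j) * (t (Suc j) * t (m - Suc j)))" for m
  have "c (n + 2) = (\<Sum>K\<in>{K. K \<subseteq> ?V - {0} \<and> 1 \<in> K}. card (cacti (?V - K)) *
       (card K * card (cacti K) +
        (\<Sum>U\<in>{U. U \<subseteq> K \<and> 1 \<in> U}. card U * card (cacti U) * (card (K - U) * card (cacti (K - U))))))"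
    unfolding c_def cactus_number_def by (rule card_cacti_decompose) auto
  also have "\<dots> = (\<Sum>K\<in>{K. K \<subseteq> ?V - {0} \<and> 1 \<in> K}. c (n + 2 - card K) * q (card K))"
  proof (intro sum.cong refl arg_cong2[of _ _ _ _ "(*)"])
    fix K assume "K \<in> {K. K \<subseteq> ?V - {0} \<and> 1 \<in> K}"
    then have K: "K \<subseteq> ?V - {0}" "1 \<in> K" by auto
    then have fin: "finite K" by (auto intro: finite_subset)
    have "K \<subseteq> ?V" using K by auto
    then show "card (cacti (?V - K)) = c (n + 2 - card K)"
      using fin by (simp add: card_cacti c_def card_Diff_subset)
    have pos: "card K = Suc (card K - 1)" using fin K by (metis Suc_pred' card_gt_0_iff empty_iff)
    have "(\<Sum>U\<in>{U. U \<subseteq> K \<and> 1 \<in> U}. card U * card (cacti U) * (card (K - U) * card (cacti (K - U))))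
      = (\<Sum>U\<in>{U. U \<subseteq> K \<and> 1 \<in> U}. t (card U) * t (card K - card U))"
    proof (intro sum.cong refl)
      fix U assume "U \<in> {U. U \<subseteq> K \<and> 1 \<in> U}"
      then have U: "U \<subseteq> K" "finite U" using fin by (auto intro: finite_subset)
      then show "card U * card (cacti U) * (card (K - U) * card (cacti (K - U))) =
          t (card U) * t (card K - card U)"
        using fin by (simp add: card_cacti t_def card_Diff_subset)
    qed
    also have "\<dots> = (\<Sum>j\<le>card K - 1. (card K - 1 choose j) * (t (Suc j) * t (card K - Suc j)))"
      by (rule sum_subsets_containing[OF fin K(2) pos, of "\<lambda>m. t m * t (card K - m)"])
    finally show "card K * card (cacti K) +
        (\<Sum>U\<in>{U. U \<subseteq> K \<and> 1 \<in> U}. card U * card (cacti U) * (card (K - U) * card (cacti (K - U))))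
        = q (card K)"
      using fin by (simp add: q_def t_def card_cacti)
  qed
  also have "\<dots> = (\<Sum>k\<le>n. (n choose k) * (c (n + 2 - Suc k) * q (Suc k)))"
    by (rule sum_subsets_containing[of "?V - {0}" 1 n "\<lambda>m. c (n + 2 - m) * q m"]) auto
  also have "\<dots> = (\<Sum>k\<le>n. (n choose k) * (c (Suc (n - k)) *
      (t (Suc k) + (\<Sum>j\<le>k. (k choose j) * (t (Suc j) * t (k - j))))))"
    by (intro sum.cong refl) (simp add: q_def Suc_diff_le)
  finally show ?thesis .
qed

section \<open>The differential equation of the generating function\<close>

lemma egf_product_nth:
  fixes a b :: "nat \<Rightarrow> nat"
  shows "(Abs_fps (\<lambda>n. real (a n) / fact n) * Abs_fps (\<lambda>n. real (b n) / fact n)) $ n =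
    real (\<Sum>k\<le>n. (n choose k) * (a k * b (n - k))) / fact n"
proof -
  have "real (a k) / fact k * (real (b (n - k)) / fact (n - k)) =
      real ((n choose k) * (a k * b (n - k))) / fact n" if "k \<le> n" for k
    using binomial_fact[OF that, where 'a = real] by (simp add: field_simps)
  then show ?thesis
    by (simp add: fps_mult_nth atLeast0AtMost sum_divide_distrib)
qed

text \<open>An index shift is a derivative and a binomial convolution is a product, so the recursion
  becomes the equation. The constant term of \<open>C\<close> is left free, as differentiation
  removes it; in the application it is 0 while \<open>cactus_number 0\<close> is 1.\<close>

lemma cactus_egf_ode:
  fixes C A T :: "real fps"
  assumes C: "\<And>n. n > 0 \<Longrightarrow> C $ n = real (cactus_number n) / fact n"
  defines "A \<equiv> fps_deriv C"
  defines "T \<equiv> fps_X * A"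
  shows "fps_deriv A = A * (fps_deriv T * (1 + T))"
proof -
  let ?c = cactus_number
  let ?t = "\<lambda>n. n * ?c n"
  have A: "A = Abs_fps (\<lambda>n. real (?c (Suc n)) / fact n)"
    by (rule fps_ext) (simp add: A_def C del: of_nat_Suc)
  have T: "T = Abs_fps (\<lambda>n. real (?t n) / fact n)"
  proof (rule fps_ext)
    fix n show "T $ n = Abs_fps (\<lambda>n. real (?t n) / fact n) $ n"
      by (cases n) (simp_all add: T_def A del: of_nat_Suc)
  qed
  have T': "fps_deriv T = Abs_fps (\<lambda>n. real (?t (Suc n)) / fact n)"
    by (rule fps_ext) (simp add: T del: of_nat_Suc, simp add: algebra_simps)
  define q where "q k = ?t (Suc k) + (\<Sum>j\<le>k. (k choose j) * (?t (Suc j) * ?t (k - j)))" for k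
  have Q: "fps_deriv T * (1 + T) = Abs_fps (\<lambda>n. real (q n) / fact n)"
  proof (rule fps_ext)
    fix n
    have "(fps_deriv T * (1 + T)) $ n = fps_deriv T $ n + (fps_deriv T * T) $ n"
      by (simp add: distrib_left)
    also have "(fps_deriv T * T) $ n = real (\<Sum>j\<le>n. (n choose j) * (?t (Suc j) * ?t (n - j))) / fact n"
      unfolding T' by (subst T) (rule egf_product_nth)
    finally show "(fps_deriv T * (1 + T)) $ n = Abs_fps (\<lambda>n. real (q n) / fact n) $ n"
      unfolding T' q_def by (simp add: add_divide_distrib)
  qed
  have "fps_deriv A = Abs_fps (\<lambda>n. real (q n) / fact n) * A"
  proof (rule fps_ext)
    fix n
    have "(Abs_fps (\<lambda>n. real (q n) / fact n) * A) $ n =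
        real (\<Sum>k\<le>n. (n choose k) * (q k * ?c (Suc (n - k)))) / fact n"
      unfolding A by (rule egf_product_nth)
    also have "(\<Sum>k\<le>n. (n choose k) * (q k * ?c (Suc (n - k)))) = ?c (n + 2)"
      unfolding cactus_number_rec q_def by (simp add: mult_ac)
    also have "real (?c (n + 2)) / fact n = fps_deriv A $ n"
      by (simp add: A del: of_nat_Suc)
    finally show "fps_deriv A $ n = (Abs_fps (\<lambda>n. real (q n) / fact n) * A) $ n" ..
  qed
  then show ?thesis unfolding Q by (simp add: mult.commute)
qed

section \<open>Singularity analysis\<close>

text \<open>Truncations are polynomials, so they can be differentiated and estimated before anything
  is known about convergence.\<close>

definition fps_trunc :: "real fps \<Rightarrow> nat \<Rightarrow> real \<Rightarrow> real" where
  "fps_trunc f n x = (\<Sum>k\<le>n. f $ k * x ^ k)"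

lemma fps_trunc_deriv:
  "(fps_trunc f (Suc n) has_real_derivative fps_trunc (fps_deriv f) n x) (at x)"
proof -
  have "fps_trunc f (Suc n) = (\<lambda>x. f $ 0 + (\<Sum>k\<le>n. f $ Suc k * x ^ Suc k))"
    by (rule ext) (simp only: fps_trunc_def sum.atMost_Suc_shift power_0 mult_1_right)
  moreover have "((\<lambda>x. f $ 0 + (\<Sum>k\<le>n. f $ Suc k * x ^ Suc k)) has_real_derivative
      (\<Sum>k\<le>n. f $ Suc k * (real (Suc k) * x ^ k))) (at x)"
    by (auto intro!: derivative_eq_intros sum.cong simp del: power_Suc)
  ultimately show ?thesis by (simp add: fps_trunc_def mult_ac)
qed

lemma fps_trunc_nonneg: "(\<And>k. f $ k \<ge> 0) \<Longrightarrow> x \<ge> 0 \<Longrightarrow> fps_trunc f n x \<ge> 0"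
  unfolding fps_trunc_def by (intro sum_nonneg) simp

lemma fps_trunc_Suc_ge: "(\<And>k. f $ k \<ge> 0) \<Longrightarrow> x \<ge> 0 \<Longrightarrow> fps_trunc f n x \<le> fps_trunc f (Suc n) x"
  unfolding fps_trunc_def by simp

lemma fps_trunc_X_mult: "fps_trunc (fps_X * f) (Suc n) x = x * fps_trunc f n x"
  unfolding fps_trunc_def sum.atMost_Suc_shift by (simp add: sum_distrib_left mult_ac)

text \<open>Multiplying the truncations yields every term of degree at most \<open>n\<close> of the
  product and further terms, all nonnegative.\<close>

lemma fps_trunc_mult_le:
  assumes "\<And>k. f $ k \<ge> 0" "\<And>k. g $ k \<ge> 0" "x \<ge> 0"
  shows "fps_trunc (f * g) n x \<le> fps_trunc f n x * fps_trunc g n x"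
proof -
  have "fps_trunc (f * g) n x = (\<Sum>k\<le>n. \<Sum>i\<le>k. (f $ i * x ^ i) * (g $ (k - i) * x ^ (k - i)))"
    unfolding fps_trunc_def fps_mult_nth atLeast0AtMost sum_distrib_right
    by (intro sum.cong refl) (simp add: mult_ac flip: power_add)
  also have "\<dots> = (\<Sum>(i, j)\<in>{(i, j). i + j \<le> n}. (f $ i * x ^ i) * (g $ j * x ^ j))"
    by (rule sum.triangle_reindex_eq[symmetric])
  also have "\<dots> \<le> (\<Sum>(i, j)\<in>{..n} \<times> {..n}. (f $ i * x ^ i) * (g $ j * x ^ j))"
    by (rule sum_mono2) (use assms in auto)
  also have "\<dots> = fps_trunc f n x * fps_trunc g n x"
    by (simp add: fps_trunc_def sum_product sum.cartesian_product)
  finally show ?thesis .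
qed

context
  fixes C A T :: "real fps"
  assumes nonneg: "\<And>n. n > 0 \<Longrightarrow> C $ n \<ge> 0" and C1: "C $ 1 = 1"
    and A_def: "A = fps_deriv C" and T_def: "T = fps_X * A"
    and ode: "fps_deriv A = A * (fps_deriv T * (1 + T))"
begin

lemma deriv_egf_nonneg: "A $ n \<ge> 0"
  by (simp add: A_def nonneg)

lemma rooted_egf_nonneg: "T $ n \<ge> 0"
  by (simp add: T_def deriv_egf_nonneg)

lemma deriv_egf_nth_0: "A $ 0 = 1"
  using C1 by (simp add: A_def)

text \<open>A Gronwall argument on the truncated differential equation: truncating a product of
  series with nonnegative coefficients only loses mass.\<close>

lemma deriv_egf_trunc_le:
  assumes "x \<ge> 0"
  shows "fps_trunc A (Suc n) x \<le> exp (fps_trunc T (Suc n) x + (fps_trunc T (Suc n) x)\<^sup>2 / 2)"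
proof -
  define P where "P = fps_trunc T (Suc n)"
  \<comment> \<open>The exponential is the integrating factor of the equation: without truncation,
    \<open>h\<close> would be constant.\<close>
  define h where "h u = fps_trunc A (Suc n) u * exp (- (P u + (P u)\<^sup>2 / 2))" for u
  have dP: "(P has_real_derivative fps_trunc (fps_deriv T) n u) (at u)" for u
    unfolding P_def by (rule fps_trunc_deriv)
  have T'_nonneg: "fps_deriv T $ k \<ge> 0" for k by (simp add: rooted_egf_nonneg)
  have T1_nonneg: "(1 + T) $ k \<ge> 0" for k using rooted_egf_nonneg by simp
  have prod_nonneg: "(fps_deriv T * (1 + T)) $ k \<ge> 0" for k
    unfolding fps_mult_nth by (intro sum_nonneg mult_nonneg_nonneg T'_nonneg T1_nonneg)
  have le: "fps_trunc (fps_deriv A) n u \<le>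
      fps_trunc A (Suc n) u * (fps_trunc (fps_deriv T) n u * (1 + P u))" if "u \<ge> 0" for u
  proof -
    have "fps_trunc (fps_deriv A) n u \<le> fps_trunc A n u * fps_trunc (fps_deriv T * (1 + T)) n u"
      unfolding ode by (rule fps_trunc_mult_le) (use deriv_egf_nonneg prod_nonneg that in auto)
    also have "\<dots> \<le> fps_trunc A n u * (fps_trunc (fps_deriv T) n u * fps_trunc (1 + T) n u)"
      by (intro mult_left_mono fps_trunc_mult_le fps_trunc_nonneg deriv_egf_nonneg T'_nonneg T1_nonneg that)
    also have "fps_trunc (1 + T) n u = 1 + fps_trunc T n u"
    proof -
      have "(\<Sum>k\<le>n. (1 :: real fps) $ k * u ^ k) = (\<Sum>k\<le>n. if k = 0 then 1 else 0)"
        by (intro sum.cong) auto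
      then show ?thesis by (simp add: fps_trunc_def ring_distribs sum.distrib)
    qed
    \<comment> \<open>Differentiation lowers the truncation order by one; raising it again brings
      back \<open>P\<close> and the order used in \<open>h\<close>.\<close>
    also have "fps_trunc A n u * (fps_trunc (fps_deriv T) n u * (1 + fps_trunc T n u)) \<le>
        fps_trunc A (Suc n) u * (fps_trunc (fps_deriv T) n u * (1 + P u))"
      unfolding P_def
      by (intro mult_mono add_left_mono fps_trunc_Suc_ge mult_nonneg_nonneg add_nonneg_nonneg
          fps_trunc_nonneg deriv_egf_nonneg rooted_egf_nonneg T'_nonneg that order_refl) simp_all
    finally show ?thesis .
  qed
  have "h x \<le> h 0"
  proof (rule DERIV_nonpos_imp_nonincreasing[OF assms])
    fix u assume u: "0 \<le> u" "u \<le> x"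
    have "(h has_real_derivative (fps_trunc (fps_deriv A) n u -
        fps_trunc A (Suc n) u * (fps_trunc (fps_deriv T) n u * (1 + P u))) *
        exp (- (P u + (P u)\<^sup>2 / 2))) (at u)"
      unfolding h_def
      by (auto intro!: derivative_eq_intros fps_trunc_deriv dP simp: algebra_simps)
    moreover have "(fps_trunc (fps_deriv A) n u -
        fps_trunc A (Suc n) u * (fps_trunc (fps_deriv T) n u * (1 + P u))) *
        exp (- (P u + (P u)\<^sup>2 / 2)) \<le> 0"
      by (intro mult_nonpos_nonneg) (use le[OF u(1)] in auto)
    ultimately show "\<exists>y. (h has_real_derivative y) (at u) \<and> y \<le> 0" by blast
  qed
  moreover have "h 0 = 1"
  proof -
    have "fps_trunc f m 0 = f $ 0" for f m
      by (induction m) (simp_all add: fps_trunc_def)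
    then show ?thesis by (simp add: h_def P_def deriv_egf_nth_0 T_def)
  qed
  ultimately have "h x * exp (P x + (P x)\<^sup>2 / 2) \<le> 1 * exp (P x + (P x)\<^sup>2 / 2)"
    by (intro mult_right_mono) auto
  moreover have "h x * exp (P x + (P x)\<^sup>2 / 2) = fps_trunc A (Suc n) x"
    unfolding h_def by (simp only: mult.assoc flip: exp_add) simp
  ultimately show ?thesis unfolding P_def by linarith
qed

text \<open>The condition on \<open>x\<close> says
  \<open>x * exp (y + y\<^sup>2 / 2) \<le> y\<close>, so the bound reproduces itself: the next
  truncation of \<open>T\<close> is \<open>x\<close> times one of \<open>A\<close>, which
  \<open>deriv_egf_trunc_le\<close> controls by the preceding truncation of \<open>T\<close>. Here
  \<open>y\<close> is any nonnegative number.\<close>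

lemma rooted_egf_trunc_le:
  assumes "0 \<le> x" "x \<le> y * exp (- (y + y\<^sup>2 / 2))" "y \<ge> 0"
  shows "fps_trunc T n x \<le> y"
proof -
  have Suc: "fps_trunc T (Suc n) x \<le> y" for n
  proof (induction n)
    case 0
    have "0 \<le> y + y\<^sup>2 / 2" using assms by simp
    then have "exp (- (y + y\<^sup>2 / 2)) \<le> 1" by (simp only: exp_le_one_iff neg_le_0_iff_le)
    then have "y * exp (- (y + y\<^sup>2 / 2)) \<le> y * 1" by (intro mult_left_mono assms)
    then show ?case using assms by (simp add: T_def fps_trunc_X_mult fps_trunc_def deriv_egf_nth_0)
  next
    case (Suc n)
    let ?P = "fps_trunc T (Suc n) x"
    have P: "0 \<le> ?P" by (intro fps_trunc_nonneg rooted_egf_nonneg assms)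
    have "fps_trunc T (Suc (Suc n)) x = x * fps_trunc A (Suc n) x"
      by (simp add: T_def fps_trunc_X_mult)
    also have "\<dots> \<le> x * exp (?P + ?P\<^sup>2 / 2)"
      by (intro mult_left_mono deriv_egf_trunc_le assms)
    also have "\<dots> \<le> (y * exp (- (y + y\<^sup>2 / 2))) * exp (y + y\<^sup>2 / 2)"
    proof (intro mult_mono)
      show "exp (?P + ?P\<^sup>2 / 2) \<le> exp (y + y\<^sup>2 / 2)"
        unfolding exp_le_cancel_iff using Suc power_mono[OF Suc P, of 2] by linarith
    qed (use assms in auto)
    also have "\<dots> = y" by (simp only: mult.assoc flip: exp_add) simp
    finally show ?case .
  qed
  show ?thesis
    by (rule order_trans[OF fps_trunc_Suc_ge[OF rooted_egf_nonneg assms(1)] Suc])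
qed

text \<open>Inside the disc the Gronwall quotient can be formed from the series themselves; its
  derivative vanishes by \<open>ode\<close>, and it equals 1 at the origin.\<close>

lemma rooted_egf_functional_equation:
  assumes "0 \<le> x" "ereal x < fps_conv_radius C"
  shows "eval_fps T x = x * exp (eval_fps T x + (eval_fps T x)\<^sup>2 / 2)"
proof -
  have rA: "fps_conv_radius C \<le> fps_conv_radius A"
    unfolding A_def by (rule fps_conv_radius_deriv)
  have rT: "fps_conv_radius C \<le> fps_conv_radius T"
    using fps_conv_radius_mult[of fps_X A] rA unfolding T_def by auto
  have rT': "fps_conv_radius C \<le> fps_conv_radius (fps_deriv T)"
    using fps_conv_radius_deriv[of T] rT by (rule order.trans[rotated])
  have rT1: "fps_conv_radius C \<le> fps_conv_radius (1 + T)"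
    using fps_conv_radius_add[of 1 T] rT by auto
  have rTT: "fps_conv_radius C \<le> fps_conv_radius (fps_deriv T * (1 + T))"
    using fps_conv_radius_mult[of "fps_deriv T" "1 + T"] rT' rT1 by (meson min.boundedI order_trans)
  define G where "G u = eval_fps A u * exp (- (eval_fps T u + (eval_fps T u)\<^sup>2 / 2))" for u
  have "G x = G 0"
  proof (cases "x = 0")
    case False
    have dG: "(G has_real_derivative 0) (at u)" if u: "0 \<le> u" "u \<le> x" for u
    proof -
      have nu: "ereal (norm u) < fps_conv_radius C"
        using u assms(2) by (auto intro: le_less_trans[of _ "ereal x"])
      have "eval_fps (fps_deriv A) u = eval_fps A u * (eval_fps (fps_deriv T) u * (1 + eval_fps T u))"
        unfolding ode using nu rA rT' rT1 rTT rT
        by (simp add: eval_fps_mult eval_fps_add less_le_trans)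
      moreover have "(eval_fps A has_real_derivative eval_fps (fps_deriv A) u) (at u)"
        using nu rA by (intro has_field_derivative_eval_fps) (auto intro: less_le_trans)
      moreover have "(eval_fps T has_real_derivative eval_fps (fps_deriv T) u) (at u)"
        using nu rT by (intro has_field_derivative_eval_fps) (auto intro: less_le_trans)
      ultimately show ?thesis
        unfolding G_def by (auto intro!: derivative_eq_intros simp: algebra_simps)
    qed
    have "continuous_on {0..x} G"
      using dG by (intro DERIV_continuous_on[where D = "\<lambda>_. 0"]) (auto intro: has_field_derivative_at_within)
    then show ?thesis using assms(1) False dG by (intro DERIV_isconst_end) auto
  qed simp
  also have "G 0 = 1" by (simp add: G_def eval_fps_at_0 deriv_egf_nth_0 T_def)
  finally have "eval_fps A x = exp (eval_fps T x + (eval_fps T x)\<^sup>2 / 2)"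
    by (simp add: G_def exp_minus field_simps)
  moreover have "eval_fps T x = x * eval_fps A x"
    unfolding T_def using assms rA by (subst eval_fps_mult) (auto intro: less_le_trans)
  ultimately show ?thesis by simp
qed

text \<open>Bounded partial sums with nonnegative terms give convergence at \<open>x\<close> itself,
  not only below it. From index 1 on, the coefficients of \<open>C\<close> are at most those of
  \<open>T\<close>, so the radius of \<open>C\<close> is at least \<open>x\<close>.\<close>

lemma rooted_egf_at_radius:
  assumes "y \<ge> 0"
  defines "x \<equiv> y * exp (- (y + y\<^sup>2 / 2))"
  shows "summable (\<lambda>n. T $ n * x ^ n)" "eval_fps T x \<le> y" "ereal x \<le> fps_conv_radius C"
proof -
  have x: "0 \<le> x" using assms by simp
  have bd: "(\<Sum>k<n. T $ k * x ^ k) \<le> y" for n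
  proof -
    have "(\<Sum>k<n. T $ k * x ^ k) \<le> fps_trunc T n x"
      unfolding fps_trunc_def by (intro sum_mono2 mult_nonneg_nonneg rooted_egf_nonneg zero_le_power x) auto
    also have "\<dots> \<le> y" using rooted_egf_trunc_le[of x y] x assms by simp
    finally show ?thesis .
  qed
  show sm: "summable (\<lambda>n. T $ n * x ^ n)"
    by (rule summableI_nonneg_bounded[OF _ bd]) (intro mult_nonneg_nonneg rooted_egf_nonneg zero_le_power x)
  show "eval_fps T x \<le> y" unfolding eval_fps_def by (intro suminf_le_const sm bd)
  have "summable (\<lambda>n. C $ n * x ^ n)"
  proof (rule summable_comparison_test'[OF sm, of 1])
    fix n :: nat assume n: "n \<ge> 1"
    then obtain m where m: "n = Suc m" by (cases n) auto
    have "C $ n \<le> T $ n"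
      using nonneg[of n] by (simp add: m T_def A_def distrib_right)
    then show "norm (C $ n * x ^ n) \<le> T $ n * x ^ n"
      using nonneg[of n] n x by (simp add: abs_mult mult_right_mono)
  qed
  then have "ereal (norm x) \<le> conv_radius (fps_nth C)" by (rule conv_radius_geI)
  then show "ereal x \<le> fps_conv_radius C" using x by (simp add: fps_conv_radius_def)
qed

text \<open>\<open>\<phi>(t) = t exp(-t - t\<^sup>2/2)\<close> increases up to its maximum at the zero \<open>y\<close> of \<open>1 - t - t\<^sup>2\<close>.\<close>

lemma conv_radius_and_value:
  fixes y :: real
  assumes y: "y > 0" "y * (1 + y) = 1"
  shows "fps_conv_radius C = ereal (y * exp (- (y + y\<^sup>2 / 2)))"
    and "eval_fps T (y * exp (- (y + y\<^sup>2 / 2))) = y"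
proof -
  define e where "e t = t + t\<^sup>2 / 2" for t :: real
  define \<phi> where "\<phi> t = t * exp (- e t)" for t :: real
  have iy: "1 / y = 1 + y" using y by (simp add: field_simps)
  have \<phi>_eq: "\<phi> t = \<phi> u * (t / u * exp (e u - e t))" if "u > 0" for t u
  proof -
    have "exp (- e t) = exp (- e u) * exp (e u - e t)" by (simp flip: exp_add)
    then show ?thesis using that by (simp add: \<phi>_def)
  qed
  \<comment> \<open>By \<open>\<phi>_eq\<close> and \<open>1 + s \<le> exp s\<close>, comparing
    values of \<open>\<phi>\<close> reduces to an inequality without exponentials.\<close>
  have key: "\<phi> t \<le> \<phi> u" if "u > 0" "t / u - 1 \<le> e t - e u" for t u
  proof -
    have "t / u \<le> exp (e t - e u)"
      using exp_ge_add_one_self[of "e t - e u"] that(2) by linarith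
    then have "t / u * exp (e u - e t) \<le> exp (e t - e u) * exp (e u - e t)"
      by (rule mult_right_mono) simp
    also have "\<dots> = 1" by (simp flip: exp_add)
    finally show ?thesis
      unfolding \<phi>_eq[OF that(1), of t] by (rule mult_left_le) (use that in \<open>simp add: \<phi>_def\<close>)
  qed
  \<comment> \<open>The Taylor expansion of the quadratic \<open>e\<close> at \<open>y\<close>,
    whose slope there is \<open>1 + y = 1 / y\<close>.\<close>
  have diff: "e t - e y - (t / y - 1) = (t - y)\<^sup>2 / 2" for t
  proof -
    have "t / y = t * (1 + y)" using iy by (metis mult.right_neutral times_divide_eq_right)
    moreover have "1 = y + y * y" using y(2) by (simp add: distrib_left)
    ultimately show ?thesis by (simp add: e_def power2_eq_square field_simps)
  qed
  have max: "\<phi> t \<le> \<phi> y" for t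
  proof (rule key[OF y(1)])
    show "t / y - 1 \<le> e t - e y" using diff[of t] zero_le_power2[of "t - y"] by linarith
  qed
  have mono: "\<phi> t \<le> \<phi> u" if "0 \<le> t" "t \<le> u" "0 < u" "u \<le> y" for t u
  proof (rule key[OF that(3)])
    \<comment> \<open>\<open>1 + (t + u) / 2\<close> is the slope of \<open>e\<close> between
      \<open>t\<close> and \<open>u\<close>; the factor \<open>t - u \<le> 0\<close> then reverses
      the comparison.\<close>
    have "1 + (t + u) / 2 \<le> 1 / y" using iy that by simp
    also have "\<dots> \<le> 1 / u" using that y by (simp add: frac_le)
    finally have "(t - u) * (1 / u) \<le> (t - u) * (1 + (t + u) / 2)"
      by (intro mult_left_mono_neg) (use that in auto)
    moreover have "(t - u) * (1 / u) = t / u - 1" using that by (simp add: diff_divide_distrib)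
    moreover have "(t - u) * (1 + (t + u) / 2) = e t - e u"
      by (simp add: e_def power2_eq_square field_simps)
    ultimately show "t / u - 1 \<le> e t - e u" by simp
  qed
  define x0 where "x0 = \<phi> y"
  have x0: "x0 > 0" using y by (simp add: x0_def \<phi>_def)
  note S = rooted_egf_at_radius[of y, folded e_def, folded \<phi>_def, folded x0_def, OF less_imp_le[OF y(1)]]
  have inv: "x = \<phi> (eval_fps T x)" if "0 \<le> x" "ereal x < fps_conv_radius C" for x
  proof -
    have "\<phi> (eval_fps T x) = x * (exp (e (eval_fps T x)) * exp (- e (eval_fps T x)))"
      using rooted_egf_functional_equation[OF that] unfolding \<phi>_def e_def by (metis mult.assoc)
    then show ?thesis by (simp flip: exp_add)
  qed
  \<comment> \<open>A point beyond \<open>x0\<close> inside the disc would be a value of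
    \<open>\<phi>\<close>, but these never exceed \<open>\<phi> y = x0\<close>.\<close>
  have R: "fps_conv_radius C = ereal x0"
  proof (rule antisym[OF _ S(3)], rule ccontr)
    assume "\<not> fps_conv_radius C \<le> ereal x0"
    then have "ereal x0 < fps_conv_radius C" by simp
    then obtain x where x: "ereal x0 < ereal x" "ereal x < fps_conv_radius C"
      using ereal_dense2 by blast
    then have "x = \<phi> (eval_fps T x)" using inv[of x] x0 by simp
    then have "x \<le> x0" using max[of "eval_fps T x"] by (simp add: x0_def)
    then show False using x by simp
  qed
  then show "fps_conv_radius C = ereal (y * exp (- (y + y\<^sup>2 / 2)))"
    by (simp add: x0_def \<phi>_def e_def)
  define t0 where "t0 = eval_fps T x0"
  have T_le: "eval_fps T x \<le> t0" "eval_fps T x \<ge> 0" if x: "0 \<le> x" "x < x0" for x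
  proof -
    have sm: "summable (\<lambda>n. T $ n * x ^ n)"
      by (rule summable_comparison_test'[OF S(1), of 0])
        (use x rooted_egf_nonneg in \<open>auto simp: abs_mult intro!: mult_left_mono power_mono\<close>)
    show "eval_fps T x \<le> t0"
      unfolding t0_def eval_fps_def
      by (intro suminf_le sm S(1) mult_left_mono power_mono rooted_egf_nonneg) (use x in auto)
    show "eval_fps T x \<ge> 0"
      unfolding eval_fps_def using sm x by (intro suminf_nonneg) (auto simp: rooted_egf_nonneg)
  qed
  have t0: "t0 > 0"
  proof -
    have "x = 0" if "0 \<le> x" "x < x0" "eval_fps T x = 0" for x
      using inv[of x] that R by (simp add: \<phi>_def)
    from this[of "x0 / 2"] x0 T_le[of "x0 / 2"] show ?thesis by force
  qed
  have t0y: "t0 \<le> y" using S(2) by (simp add: t0_def)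
  \<comment> \<open>The functional equation is available only below \<open>x0\<close>, so it reaches
    the boundary as an inequality, by letting \<open>x\<close> grow to \<open>x0\<close>.\<close>
  have "x0 \<le> \<phi> t0"
  proof (rule dense_le_bounded[OF x0])
    fix x assume x: "0 < x" "x < x0"
    then have "x = \<phi> (eval_fps T x)" using inv[of x] R by simp
    also have "\<dots> \<le> \<phi> t0" using T_le[of x] x t0 t0y by (intro mono) auto
    finally show "x \<le> \<phi> t0" .
  qed
  \<comment> \<open>The maximum is strict: for \<open>t0 \<noteq> y\<close> the square in
    \<open>diff\<close> is positive, so \<open>\<phi> t0 < \<phi> y = x0\<close>.\<close>
  have "t0 = y"
  proof (rule ccontr)
    assume "t0 \<noteq> y"
    then have "0 < (t0 - y)\<^sup>2 / 2" by simp
    then have "t0 / y < exp (e t0 - e y)"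
      using diff[of t0] exp_ge_add_one_self[of "e t0 - e y"] by linarith
    then have "t0 / y * exp (e y - e t0) < exp (e t0 - e y) * exp (e y - e t0)"
      by (rule mult_strict_right_mono) simp
    also have "\<dots> = 1" by (simp flip: exp_add)
    finally have "\<phi> y * (t0 / y * exp (e y - e t0)) < \<phi> y * 1"
      using x0 by (intro mult_strict_left_mono) (auto simp: x0_def)
    then have "\<phi> t0 < \<phi> y"
      unfolding \<phi>_eq[OF y(1), of t0, symmetric] by simp
    then show False using \<open>x0 \<le> \<phi> t0\<close> by (simp add: x0_def)
  qed
  then show "eval_fps T (y * exp (- (y + y\<^sup>2 / 2))) = y"
    by (simp add: t0_def x0_def \<phi>_def e_def)
qed

end

section \<open>Blocks and the Boltzmann distribution\<close>

definition complete_on :: "'a set \<Rightarrow> 'a pair_pre_digraph" where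
  "complete_on V = \<lparr>pverts = V, parcs = {(x, y). x \<in> V \<and> y \<in> V \<and> x \<noteq> y}\<rparr>"

lemma complete_on_simps [simp]:
  "pverts (complete_on V) = V" "(x, y) \<in> parcs (complete_on V) \<longleftrightarrow> x \<in> V \<and> y \<in> V \<and> x \<noteq> y"
  by (simp_all add: complete_on_def)

lemma cacti_singleton: "{} \<in> cacti {x}"
  by (auto intro!: cactiI simp: sym_def)

lemma complete_on_cacti:
  assumes "card V \<in> {2, 3}"
  shows "parcs (complete_on V) \<in> cacti V"
proof -
  consider u v where "V = {u, v}" "u \<noteq> v" | u v w where "V = {u, v, w}" "u \<noteq> v" "u \<noteq> w" "v \<noteq> w"
    using assms by (auto simp: card_2_iff card_3_iff)
  then show ?thesis
  proof cases
    case 1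
    have "parcs (complete_on V) = {} \<union> {} \<union> edge_arcs u v"
      using 1 by (auto simp: complete_on_def edge_arcs_def)
    moreover have "V = {u} \<union> {v}" using 1 by auto
    ultimately show ?thesis
      using cacti_glue_edge[OF cacti_singleton cacti_singleton, of u v u v] 1 by simp
  next
    case 2
    have "parcs (complete_on V) = {} \<union> {} \<union> {} \<union> tri_arcs u v w"
      using 2 by (auto simp: complete_on_def tri_arcs_def)
    moreover have "V = {u} \<union> {v} \<union> {w}" using 2 by auto
    ultimately show ?thesis
      using cacti_glue_triangle[OF cacti_singleton cacti_singleton cacti_singleton, of u v w u v w] 2
      by simp
  qed
qed

lemma reachable_del_vert_iff:
  assumes "parcs G \<subseteq> pverts G \<times> pverts G"
  shows "a \<rightarrow>\<^sup>*\<^bsub>pre_digraph.del_vert (with_proj G) v\<^esub> b \<longleftrightarrow>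
    a \<in> pverts G - {v} \<and> (a, b) \<in> (parcs G \<inter> (-{v}) \<times> (-{v}))\<^sup>*"
proof -
  let ?H = "\<lparr>pverts = pverts G - {v}, parcs = parcs G \<inter> (-{v}) \<times> (-{v})\<rparr>"
  have "pre_digraph.del_vert (with_proj G) v = with_proj ?H"
    by (auto simp: pre_digraph.del_vert_def with_proj_def)
  then show ?thesis
    using reachable_with_proj_iff[of ?H a b] assms by auto
qed

text \<open>If \<open>X\<close> had a vertex \<open>x\<close> besides \<open>a\<close>, every path
  from \<open>x\<close> to \<open>z\<close> would leave \<open>X\<close> through \<open>a\<close>,
  so deleting \<open>a\<close> would separate them.\<close>

lemma no_cutvertexD:
  assumes E: "E \<in> cacti V" and V: "V = pverts G" "E = parcs G" and no: "\<not> (\<exists>v. cutvertex G v)"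
    and X: "a \<in> X" "X \<subseteq> V" "z \<in> V" "z \<notin> X"
    and exit: "\<And>x y. (x, y) \<in> E \<Longrightarrow> x \<in> X \<Longrightarrow> y \<notin> X \<Longrightarrow> x = a"
  shows "X = {a}"
proof (rule ccontr)
  assume "X \<noteq> {a}"
  then obtain x where x: "x \<in> X" "x \<noteq> a" using X by auto
  have sub: "parcs G \<subseteq> pverts G \<times> pverts G" using cacti_subset[OF E] V by simp
  have "(x, z) \<notin> (E \<inter> (-{a}) \<times> (-{a}))\<^sup>*"
    using rtrancl_closed[of x z "E \<inter> (-{a}) \<times> (-{a})" X] x X exit by blast
  moreover have "(x, z) \<in> E\<^sup>*" using cacti_connected[OF E] x X by auto
  ultimately have "cutvertex G a"
    unfolding cutvertex_def reachable_with_proj_iff[OF sub] reachable_del_vert_iff[OF sub] V[symmetric]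
    by (intro conjI exI[of _ x] exI[of _ z]) (use x X in auto)
  then show False using no by blast
qed

text \<open>Split at the block of any arc. Each part hangs at one vertex of the block, which would
  be a cutvertex if the part had further vertices; so the block is the whole graph, and three
  vertices rule out a bridge.\<close>

lemma two_connected_cactus:
  assumes E: "E \<in> cacti V" and V: "V = pverts G" "E = parcs G" and no: "\<not> (\<exists>v. cutvertex G v)"
    and card: "card V \<ge> 3"
  shows "card V = 3 \<and> G = complete_on V"
proof -
  have fin: "finite V" using card by (rule card_ge_0_finite[OF less_le_trans[rotated]]) simp
  obtain x y where xy: "x \<in> V" "y \<in> V" "x \<noteq> y"
    using card by (metis One_nat_def card_le_Suc0_iff_eq fin not_less_eq_eq numeral_3_eq_3 order_trans le_SucI)
  then have "(x, y) \<in> E\<^sup>*" using cacti_connected[OF E] by auto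
  then obtain v where uv: "(x, v) \<in> E" using xy(3) by (auto elim: converse_rtranclE)
  note sub = cacti_subset[OF E]
  from cacti_in_block[OF E uv] consider "bridge E x v" | w where "tri_block E x v w"
    unfolding in_block_def by auto
  then show ?thesis
  proof cases
    case 1
    obtain V1 V2 where S: "V1 \<union> V2 = V" "V1 \<inter> V2 = {}" "x \<in> V1" "v \<in> V2"
      "E = E \<inter> V1 \<times> V1 \<union> E \<inter> V2 \<times> V2 \<union> edge_arcs x v"
      by (rule cacti_split_bridge[OF E 1])
    have arcs: "a \<in> V1 \<and> b \<in> V1 \<or> a \<in> V2 \<and> b \<in> V2 \<or> (a, b) \<in> edge_arcs x v"
      if "(a, b) \<in> E" for a b
      using that by (subst (asm) S(5)) auto
    have "V1 = {x}"
    proof (rule no_cutvertexD[OF E V no, of x V1 v])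
      show "a = x" if "(a, b) \<in> E" "a \<in> V1" "b \<notin> V1" for a b
        using arcs[OF that(1)] that(2,3) S(2-4) by (auto simp: edge_arcs_def)
    qed (use S in auto)
    moreover have "V2 = {v}"
    proof (rule no_cutvertexD[OF E V no, of v V2 x])
      show "a = v" if "(a, b) \<in> E" "a \<in> V2" "b \<notin> V2" for a b
        using arcs[OF that(1)] that(2,3) S(2-4) by (auto simp: edge_arcs_def)
    qed (use S in auto)
    ultimately have "card V \<le> 2" using S(1) by (auto simp: card_insert_if)
    then show ?thesis using card by simp
  next
    case 2
    obtain V1 V2 V3 where S: "V1 \<union> V2 \<union> V3 = V" "V1 \<inter> V2 = {}" "V1 \<inter> V3 = {}" "V2 \<inter> V3 = {}"
      "x \<in> V1" "v \<in> V2" "w \<in> V3"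
      "E = E \<inter> V1 \<times> V1 \<union> E \<inter> V2 \<times> V2 \<union> E \<inter> V3 \<times> V3 \<union> tri_arcs x v w"
      by (rule cacti_split_triangle[OF E 2])
    have arcs: "a \<in> V1 \<and> b \<in> V1 \<or> a \<in> V2 \<and> b \<in> V2 \<or> a \<in> V3 \<and> b \<in> V3 \<or> (a, b) \<in> tri_arcs x v w"
      if "(a, b) \<in> E" for a b
      using that by (subst (asm) S(8)) auto
    have "V1 = {x}"
    proof (rule no_cutvertexD[OF E V no, of x V1 v])
      show "a = x" if "(a, b) \<in> E" "a \<in> V1" "b \<notin> V1" for a b
        using arcs[OF that(1)] that(2,3) S(2-7) by (auto simp: tri_arcs_def)
    qed (use S in auto)
    moreover have "V2 = {v}"
    proof (rule no_cutvertexD[OF E V no, of v V2 x])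
      show "a = v" if "(a, b) \<in> E" "a \<in> V2" "b \<notin> V2" for a b
        using arcs[OF that(1)] that(2,3) S(2-7) by (auto simp: tri_arcs_def)
    qed (use S in auto)
    moreover have "V3 = {w}"
    proof (rule no_cutvertexD[OF E V no, of w V3 x])
      show "a = w" if "(a, b) \<in> E" "a \<in> V3" "b \<notin> V3" for a b
        using arcs[OF that(1)] that(2,3) S(2-7) by (auto simp: tri_arcs_def)
    qed (use S in auto)
    ultimately have V3: "V = {x, v, w}" using S(1) by auto
    have ne: "x \<noteq> v" "x \<noteq> w" "v \<noteq> w" using tri_block_neq[OF 2] by auto
    have "E = {(x, y). x \<in> V \<and> y \<in> V \<and> x \<noteq> y}"
    proof
      show "E \<subseteq> {(x, y). x \<in> V \<and> y \<in> V \<and> x \<noteq> y}" using sub cacti_irrefl[OF E] by auto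
      show "{(x, y). x \<in> V \<and> y \<in> V \<and> x \<noteq> y} \<subseteq> E"
        using 2 unfolding V3 tri_block_def tri_arcs_def by auto
    qed
    then have "G = complete_on V"
      using V by (intro pair_pre_digraph.equality) (auto simp: complete_on_def)
    then show ?thesis using V3 ne by simp
  qed
qed

lemma blocks_iff:
  "G \<in> blocks_of (Forb (cycle_graph 4)) \<longleftrightarrow> card (pverts G) \<in> {2, 3} \<and> G = complete_on (pverts G)"
proof
  assume "G \<in> blocks_of (Forb (cycle_graph 4))"
  then have G: "G \<in> Forb (cycle_graph 4)" "two_connected G \<or> single_edge G"
    by (auto simp: blocks_of_def)
  have c: "parcs G \<in> cacti (pverts G)" using G(1) by (simp add: Forb_C4_iff)
  from G(2) show "card (pverts G) \<in> {2, 3} \<and> G = complete_on (pverts G)"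
  proof
    assume "two_connected G"
    then show ?thesis using two_connected_cactus[OF c refl refl] by (auto simp: two_connected_def)
  next
    assume "single_edge G"
    then obtain u v where "u \<noteq> v" "G = \<lparr>pverts = {u, v}, parcs = {(u, v), (v, u)}\<rparr>"
      by (auto simp: single_edge_def)
    then show ?thesis by (auto simp: complete_on_def)
  qed
next
  assume G: "card (pverts G) \<in> {2, 3} \<and> G = complete_on (pverts G)"
  define V where "V = pverts G"
  have G': "card V \<in> {2, 3}" "G = complete_on V" using G by (auto simp: V_def)
  have fin: "finite V" "V \<noteq> {}" using G'(1) by (auto intro: card_ge_0_finite)
  then have F: "G \<in> Forb (cycle_graph 4)"
    using complete_on_cacti[OF G'(1)] G'(2) by (simp add: Forb_C4_iff)
  have "two_connected G \<or> single_edge G"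
  proof (cases "card V = 2")
    case True
    then obtain u v where "V = {u, v}" "u \<noteq> v" by (auto simp: card_2_iff)
    then show ?thesis
      unfolding single_edge_def G'(2)
      by (intro disjI2 exI[of _ u] exI[of _ v]) (auto simp: complete_on_def)
  next
    case False
    have sub: "parcs G \<subseteq> pverts G \<times> pverts G" by (auto simp: G'(2))
    have "\<not> cutvertex G v" for v
    proof
      assume "cutvertex G v"
      then obtain a b where ab: "a \<noteq> v" "b \<noteq> v" "a \<in> V" "(a, b) \<in> (parcs G)\<^sup>*"
        "(a, b) \<notin> (parcs G \<inter> (-{v}) \<times> (-{v}))\<^sup>*"
        unfolding cutvertex_def reachable_with_proj_iff[OF sub] reachable_del_vert_iff[OF sub] V_def
        by blast
      have "b \<in> V" using rtrancl_closed[OF ab(4,3)] by (auto simp: G'(2))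
      then show False using ab by (cases "a = b") (auto simp: G'(2))
    qed
    moreover have "card V = 3" using G'(1) False by auto
    ultimately show ?thesis using F by (simp add: two_connected_def V_def[symmetric] Forb_def)
  qed
  then show "G \<in> blocks_of (Forb (cycle_graph 4))" using F by (simp add: blocks_of_def)
qed

section \<open>The generating functions and the parameter \<open>y\<close>\<close>

lemma card_Forb_C4:
  assumes "n > 0"
  shows "card {G \<in> Forb (cycle_graph 4). pverts G = {1..n}} = cactus_number n"
proof -
  have "bij_betw parcs {G \<in> Forb (cycle_graph 4). pverts G = {1..n}} (cacti {1..n})"
    by (rule bij_betw_byWitness[where f' = "\<lambda>E. \<lparr>pverts = {1..n}, parcs = E\<rparr>"])
      (use assms in \<open>auto simp: Forb_C4_iff\<close>)
  then show ?thesis by (simp add: bij_betw_same_card card_cacti)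
qed

lemma egf_blocks_nth:
  "fps_nth (egf (blocks_of (Forb (cycle_graph 4)))) n = (if n \<in> {2, 3} then 1 / fact n else 0)"
proof -
  have "{G \<in> blocks_of (Forb (cycle_graph 4)). pverts G = {1..n}} =
      (if n \<in> {2, 3} then {complete_on {1..n}} else {})"
    by (auto simp: blocks_iff)
  then show ?thesis by (simp add: egf_def)
qed

lemma eval_dp_egf_blocks: "eval_fps (dp_egf (blocks_of (Forb (cycle_graph 4)))) y = y + y\<^sup>2"
proof -
  have "dp_egf (blocks_of (Forb (cycle_graph 4))) = fps_X + fps_X ^ 2"
  proof (rule fps_ext)
    fix n
    show "fps_nth (dp_egf (blocks_of (Forb (cycle_graph 4)))) n = fps_nth (fps_X + fps_X ^ 2) n"
    proof (cases n)
      case (Suc m)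
      have "m = 0 \<or> m = 1 \<or> m \<ge> 2" by auto
      then show ?thesis
        by (auto simp: Suc dp_egf_def egf_blocks_nth fps_X_power_iff fact_numeral)
    qed (simp add: dp_egf_def)
  qed
  then show ?thesis by (simp add: eval_fps_add)
qed

lemma y_param_Forb_C4: "y_param (Forb (cycle_graph 4)) = (sqrt 5 - 1) / 2"
proof -
  let ?C = "egf (Forb (cycle_graph 4))"
  let ?y = "(sqrt 5 - 1) / 2 :: real"
  have C: "fps_nth ?C n = real (cactus_number n) / fact n" if "n > 0" for n
    using card_Forb_C4[OF that] by (simp add: egf_def)
  have y: "?y > 0" "?y * (1 + ?y) = 1"
    using real_sqrt_less_mono[of 1 5] by (auto simp: field_simps)
  have nonneg: "fps_nth ?C n \<ge> 0" for n by (simp add: egf_def)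
  have C1: "fps_nth ?C 1 = 1" by (simp add: C cactus_number_1)
  have ode: "fps_deriv (fps_deriv ?C) = fps_deriv ?C *
      (fps_deriv (fps_X * fps_deriv ?C) * (1 + fps_X * fps_deriv ?C))"
    by (rule cactus_egf_ode[OF C])
  note R = conv_radius_and_value[OF nonneg C1 refl refl ode y]
  show ?thesis unfolding y_param_def rho_def R(1) by (simp only: R(2) real_of_ereal.simps)
qed

text \<open>The single edge admits one root and the triangle two, as the vertex 0 cannot be the
  root.\<close>

lemma dp_objects_blocks:
  "(\<Union>m. dp_objects (blocks_of (Forb (cycle_graph 4))) m) =
    {(complete_on {0, 1}, 1), (complete_on {0, 1, 2}, 1), (complete_on {0, 1, 2}, 2)}"
proof -
  have V: "insert 0 {1..m} = {0..m}" for m :: nat by auto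
  have small: "{0..Suc 0} = {0, 1}" "{0..2} = {0, 1, 2::nat}" "{1..Suc 0} = {1}" "{1..2} = {1, 2::nat}"
    by auto
  have "dp_objects (blocks_of (Forb (cycle_graph 4))) m =
      (if m \<in> {1, 2} then {complete_on {0..m}} \<times> {1..m} else {})" for m
    unfolding dp_objects_def V by (auto simp: blocks_iff)
  then have "(\<Union>m. dp_objects (blocks_of (Forb (cycle_graph 4))) m) =
      {complete_on {0..1}} \<times> {1..1} \<union> {complete_on {0..2}} \<times> {1..2}"
    by (auto split: if_splits)
  then show ?thesis by (auto simp: small)
qed

lemma sp_complete_on:
  assumes "finite V" "0 \<in> V" "r \<in> V" "r \<noteq> 0"
  shows "sp (complete_on V, r) = 1"
proof -
  let ?G = "with_proj (complete_on V)"
  interpret pair_wf_digraph "complete_on V" by unfold_locales auto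
  have "\<mu> (\<lambda>_. 1) 0 r = 1"
  proof (rule antisym)
    have "awalk 0 [(0, r)] r" using assms by (simp add: awalk_simps)
    from min_cost_le_walk_cost[OF this, of "\<lambda>_. 1"] show "\<mu> (\<lambda>_. 1) 0 r \<le> 1" by (simp add: one_ereal_def)
    show "1 \<le> \<mu> (\<lambda>_. 1) 0 r"
      unfolding \<mu>_def
    proof (rule INF_greatest)
      fix p assume "p \<in> {p. awalk 0 p r}"
      then have "p \<noteq> []" using assms by (auto simp: awalk_Nil_iff)
      then have "1 \<le> awalk_cost (\<lambda>_. 1) p"
        by (cases p) (auto simp: awalk_cost_def sum_list_triv)
      then show "1 \<le> ereal (awalk_cost (\<lambda>_. 1) p)" by (simp add: one_ereal_def)
    qed
  qed
  then show ?thesis by (simp add: sp_def)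
qed

theorem proposition8p2:
  shows "kappa (Forb (cycle_graph 4)) = 1 \<and> sigma_sq (Forb (cycle_graph 4)) = (5 - sqrt 5) / 2"
proof -
  define y where "y = (sqrt 5 - 1) / 2"
  have y: "y > 0" "y + y\<^sup>2 = 1"
    using real_sqrt_less_mono[of 1 5] by (auto simp: y_def power2_eq_square field_simps)
  let ?B = "blocks_of (Forb (cycle_graph 4))"
  let ?e = "(complete_on {0, 1}, 1) :: nat pair_pre_digraph \<times> nat"
  let ?t1 = "(complete_on {0, 1, 2}, 1) :: nat pair_pre_digraph \<times> nat"
  let ?t2 = "(complete_on {0, 1, 2}, 2) :: nat pair_pre_digraph \<times> nat"
  define S where "S = {?e, ?t1, ?t2}"
  define f where "f X = (if X \<in> S then y ^ dp_size X / fact (dp_size X) else 0)" for X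
  have ne: "complete_on {0, 1} \<noteq> complete_on {0, 1, 2 :: nat}"
    by (auto dest!: arg_cong[of _ _ pverts])
  have sum_S: "(\<Sum>X\<in>S. g X) = g ?e + g ?t1 + g ?t2" for g :: "_ \<Rightarrow> real"
    using ne by (simp add: S_def)
  have size: "dp_size ?e = 1" "dp_size ?t1 = 2" "dp_size ?t2 = 2"
    by (simp_all add: dp_size_def)
  have sp: "sp ?e = 1" "sp ?t1 = 1" "sp ?t2 = 1" by (intro sp_complete_on; simp)+
  have f: "f ?e = y" "f ?t1 = y\<^sup>2 / 2" "f ?t2 = y\<^sup>2 / 2"
    unfolding f_def size by (simp_all add: S_def)
  have f_nonneg: "0 \<le> f X" for X using y(1) by (simp add: f_def)
  \<comment> \<open>The normalising constant is \<open>y + y\<^sup>2 = 1\<close>, so it disappears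
    from the weights.\<close>
  have boltzmann: "boltzmann_dp ?B y = embed_pmf f"
    unfolding boltzmann_dp_def eval_dp_egf_blocks y(2) dp_objects_blocks f_def S_def mult_1_right ..
  have "(\<integral>\<^sup>+ X. ennreal (f X) \<partial>count_space UNIV) = (\<Sum>X\<in>S. ennreal (f X))"
  proof (rule nn_integral_count_space')
    show "ennreal (f X) = 0" if "X \<notin> S" for X using that by (simp add: f_def)
  qed (simp_all add: S_def)
  also have "\<dots> = ennreal (\<Sum>X\<in>S. f X)"
    by (rule sum_ennreal) (rule f_nonneg)
  also have "\<dots> = 1" unfolding sum_S f using y(2) by simp
  finally have pmf: "pmf (embed_pmf f) X = f X" for X
    by (intro pmf_embed_pmf f_nonneg)
  have expectation: "measure_pmf.expectation (boltzmann_dp ?B y) g =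
      g ?e * y + g ?t1 * (y\<^sup>2 / 2) + g ?t2 * (y\<^sup>2 / 2)" for g
  proof -
    have "measure_pmf.expectation (embed_pmf f) g = (\<Sum>X\<in>S. g X * pmf (embed_pmf f) X)"
    proof (rule integral_measure_pmf_real)
      show "X \<in> S" if "X \<in> set_pmf (embed_pmf f)" for X
        using that by (simp add: set_pmf_eq pmf f_def split: if_splits)
    qed (simp add: S_def)
    then show ?thesis unfolding boltzmann pmf sum_S f .
  qed
  \<comment> \<open>All three distances are 1, so the expectation is the total mass.\<close>
  have "kappa (Forb (cycle_graph 4)) = 1"
    using y(2) unfolding kappa_def y_param_Forb_C4 y_def[symmetric] expectation sp by simp
  moreover have "sigma_sq (Forb (cycle_graph 4)) = (5 - sqrt 5) / 2"
  proof -
    have "sigma_sq (Forb (cycle_graph 4)) = y + 2 * y\<^sup>2"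
      unfolding sigma_sq_def y_param_Forb_C4 y_def[symmetric] expectation size by simp
    \<comment> \<open>By \<open>y\<^sup>2 = 1 - y\<close>; the same number is
      \<open>1 + y\<^sup>2\<close>.\<close>
    also have "\<dots> = 2 - y" using y(2) by simp
    also have "\<dots> = (5 - sqrt 5) / 2" by (simp add: y_def field_simps)
    finally show ?thesis .
  qed
  ultimately show ?thesis ..
qed

end
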